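(* Let $p\in(1,\infty)$, let $\mathcal D$ be a dyadic system on $\mathbb R^d$, let $\mu$ be a locally finite Borel measure on $\mathbb R^d$, and let $b\in L^1_{\mathrm{loc}}(\mathbb R^d,\mu)$. If the dyadic paraproduct $P_{b,\mathcal D}:L^p(\mathbb R^d,\mu)\to L^p(\mathbb R^d,\mu)$ is compact, then $b\in\mathrm{VMO}^p(\mathbb R^d,\mathcal D,\mu)$.
   Context: Dyadic system: $\mathcal D=\bigcup_{k\in\mathbb Z}\mathcal D_k$, where each $\mathcal D_k$ is a partition of $\mathbb R^d$ into half-open cubes of side-length $2^{-k}$ and $\mathcal D_{k+1}$ refines $\mathcal D_k$. Averages: $\langle f\rangle_Q:=\frac1{\mu(Q)}\int_Q f\,d\mu$, with the convention $\langle f\rangle_Q:=0$ if $\mu(Q)=0$. Mean oscillation: $\operatorname{osc}_p(b,Q):=\big(\frac1{\mu(Q)}\int_Q|b-\langle b\rangle_Q|^p\,d\mu\big)^{1/p}$, with $\operatorname{osc}_p(b,Q):=0$ if $\mu(Q)=0$. Dyadic paraproduct: the dyadic children $\operatorname{ch}_{\mathcal D}(Q)$ of $Q\in\mathcal D$ are the maximal (with respect to inclusion) cubes $P\in\mathcal D$ with $P\subsetneq Q$; $$D_Qb:=\sum_{P\in\operatorname{ch}_{\mathcal D}(Q)}(\langle b\rangle_P-\langle b\rangle_Q)1_P,\qquad P_{b,\mathcal D}f:=\sum_{Q\in\mathcal D}D_Qb\,\langle f\rangle_Q1_Q,$$ where the series is understood as converging unconditionally in $L^p(\mathbb R^d,\mu)$;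 saying that $P_{b,\mathcal D}$ is compact on $L^p(\mathbb R^d,\mu)$ means that the series converges for every $f\in L^p(\mathbb R^d,\mu)$ and defines a compact linear operator. $\mathrm{BMO}^p(\mathbb R^d,\mathcal D,\mu)$ is the set of $b\in L^1_{\mathrm{loc}}(\mathbb R^d,\mu)$ with $\sup_{Q\in\mathcal D}\operatorname{osc}_p(b,Q)<\infty$. $\mathrm{VMO}^p(\mathbb R^d,\mathcal D,\mu)$ is the set of $b\in\mathrm{BMO}^p(\mathbb R^d,\mathcal D,\mu)$ such that $$\lim_{M\to\infty}\sup_{Q\in\mathcal D:\,\mu(Q)\ge M}\operatorname{osc}_p(b,Q)=0,\quad \lim_{M\to\infty}\sup_{Q\in\mathcal D:\,\mu(Q)\le1/M}\operatorname{osc}_p(b,Q)=0,\quad \lim_{M\to\infty}\sup_{Q\in\mathcal D:\,\operatorname{dist}(0,Q)\ge M}\operatorname{osc}_p(b,Q)=0$$ (heavy, light and distant cubes), with supremum over an empty collection equal to $0$. *)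

theory Defs
  imports "HOL-Analysis.Analysis" "HOL-Library.Disjoint_Sets"
begin

text \<open>Functions take values in a Banach field \<open>'b\<close> over the reals, which covers both
  the real and the complex scalar field. Functions are not identified when they agree almost
  everywhere; statements about \<open>L\<^sup>p\<close> are phrased up to null sets instead.\<close>

definition half_open_cube :: "real ^ 'd \<Rightarrow> real \<Rightarrow> (real ^ 'd) set" where
  "half_open_cube a l = {x. \<forall>i. a $ i \<le> x $ i \<and> x $ i < a $ i + l}"

definition dyadic_system :: "(real ^ 'd) set set \<Rightarrow> bool" where
  "dyadic_system D \<longleftrightarrow>
    (\<exists>G :: int \<Rightarrow> (real ^ 'd) set set.
      (\<forall>k. partition_on UNIV (G k)) \<and>
      (\<forall>k. \<forall>Q\<in>G k. \<exists>a. Q = half_open_cube a (2 powi (- k))) \<and>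
      (\<forall>k. \<forall>P\<in>G (k + 1). \<exists>Q\<in>G k. P \<subseteq> Q) \<and>
      D = (\<Union>k. G k))"

definition dyadic_children :: "'a set set \<Rightarrow> 'a set \<Rightarrow> 'a set set" where
  "dyadic_children D Q = {P \<in> D. P \<subset> Q \<and> \<not> (\<exists>R\<in>D. P \<subset> R \<and> R \<subset> Q)}"

definition locally_finite_borel_measure :: "'a::topological_space measure \<Rightarrow> bool" where
  "locally_finite_borel_measure \<mu> \<longleftrightarrow>
    sets \<mu> = sets borel \<and> (\<forall>x. \<exists>U. open U \<and> x \<in> U \<and> emeasure \<mu> U < \<infinity>)"

definition L1_loc ::
  "'a::topological_space measure \<Rightarrow> ('a \<Rightarrow> 'b::{real_normed_field, banach, second_countable_topology}) set" where
  "L1_loc \<mu> = {f \<in> borel_measurable \<mu>. \<forall>K. compact K \<longrightarrow> set_integrable \<mu> K f}"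

text \<open>\<open>L\<^sup>p\<close> seminorms and oscillations are valued in \<open>ennreal\<close>, so that they are infinite
  (and not zero, as the Bochner integral would be) where integrability fails.\<close>

definition ennreal_powr :: "ennreal \<Rightarrow> real \<Rightarrow> ennreal" where
  "ennreal_powr x a = (if x = \<infinity> then \<infinity> else ennreal (enn2real x powr a))"

definition Lp_norm :: "real \<Rightarrow> 'a measure \<Rightarrow> ('a \<Rightarrow> 'b::real_normed_vector) \<Rightarrow> ennreal" where
  "Lp_norm p \<mu> f = ennreal_powr (\<integral>\<^sup>+x. ennreal (norm (f x) powr p) \<partial>\<mu>) (1 / p)"

definition Lp :: "real \<Rightarrow> 'a measure \<Rightarrow> ('a \<Rightarrow> 'b::real_normed_vector) set" where
  "Lp p \<mu> = {f \<in> borel_measurable \<mu>. Lp_norm p \<mu> f < \<infinity>}"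

text \<open>The first two conditions say that \<open>T\<close> induces a map on \<open>L\<^sup>p\<close> modulo null functions.\<close>

definition linear_operator_Lp ::
  "real \<Rightarrow> 'a measure \<Rightarrow> (('a \<Rightarrow> 'b::real_normed_field) \<Rightarrow> ('a \<Rightarrow> 'b)) \<Rightarrow> bool" where
  "linear_operator_Lp p \<mu> T \<longleftrightarrow>
    (\<forall>f\<in>Lp p \<mu>. T f \<in> Lp p \<mu>) \<and>
    (\<forall>f\<in>Lp p \<mu>. \<forall>g\<in>Lp p \<mu>. (AE x in \<mu>. f x = g x) \<longrightarrow> (AE x in \<mu>. T f x = T g x)) \<and>
    (\<forall>f\<in>Lp p \<mu>. \<forall>g\<in>Lp p \<mu>. AE x in \<mu>. T (\<lambda>y. f y + g y) x = T f x + T g x) \<and>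
    (\<forall>c. \<forall>f\<in>Lp p \<mu>. AE x in \<mu>. T (\<lambda>y. c * f y) x = c * T f x)"

definition compact_operator_Lp ::
  "real \<Rightarrow> 'a measure \<Rightarrow> (('a \<Rightarrow> 'b::real_normed_field) \<Rightarrow> ('a \<Rightarrow> 'b)) \<Rightarrow> bool" where
  "compact_operator_Lp p \<mu> T \<longleftrightarrow>
    linear_operator_Lp p \<mu> T \<and>
    (\<forall>f :: nat \<Rightarrow> 'a \<Rightarrow> 'b. \<forall>C :: real.
      (\<forall>n. f n \<in> Lp p \<mu> \<and> Lp_norm p \<mu> (f n) \<le> ennreal C) \<longrightarrow>
      (\<exists>r :: nat \<Rightarrow> nat. \<exists>g\<in>Lp p \<mu>. strict_mono r \<and>
        (\<lambda>n. Lp_norm p \<mu> (\<lambda>x. T (f (r n)) x - g x)) \<longlonglongrightarrow> 0))"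

definition average ::
  "'a measure \<Rightarrow> 'a set \<Rightarrow> ('a \<Rightarrow> 'b::{real_normed_field, banach, second_countable_topology}) \<Rightarrow> 'b" where
  "average \<mu> Q f =
    (if emeasure \<mu> Q = 0 then 0 else (1 / measure \<mu> Q) *\<^sub>R (LINT x:Q|\<mu>. f x))"

definition osc ::
  "real \<Rightarrow> 'a measure \<Rightarrow> ('a \<Rightarrow> 'b::{real_normed_field, banach, second_countable_topology})
    \<Rightarrow> 'a set \<Rightarrow> ennreal" where
  "osc p \<mu> b Q =
    (if emeasure \<mu> Q = 0 then 0
     else ennreal_powr
       ((\<integral>\<^sup>+x\<in>Q. ennreal (norm (b x - average \<mu> Q b) powr p) \<partial>\<mu>) / emeasure \<mu> Q) (1 / p))"

definition dyadic_difference ::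
  "'a set set \<Rightarrow> 'a measure \<Rightarrow> ('a \<Rightarrow> 'b::{real_normed_field, banach, second_countable_topology})
    \<Rightarrow> 'a set \<Rightarrow> 'a \<Rightarrow> 'b" where
  "dyadic_difference D \<mu> b Q x =
    (\<Sum>P\<in>dyadic_children D Q. (average \<mu> P b - average \<mu> Q b) * indicator P x)"

text \<open>Unconditional convergence is convergence in \<open>L\<^sup>p\<close> of the net of partial sums over
  finite subsets of \<open>D\<close>.\<close>

definition paraproduct_converges_to ::
  "real \<Rightarrow> 'a set set \<Rightarrow> 'a measure \<Rightarrow> ('a \<Rightarrow> 'b::{real_normed_field, banach, second_countable_topology})
    \<Rightarrow> ('a \<Rightarrow> 'b) \<Rightarrow> ('a \<Rightarrow> 'b) \<Rightarrow> bool" where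
  "paraproduct_converges_to p D \<mu> b f g \<longleftrightarrow>
    g \<in> Lp p \<mu> \<and>
    ((\<lambda>F. Lp_norm p \<mu>
        (\<lambda>x. (\<Sum>Q\<in>F. dyadic_difference D \<mu> b Q x * average \<mu> Q f * indicator Q x) - g x))
      \<longlongrightarrow> 0) (finite_subsets_at_top D)"

definition paraproduct_compact ::
  "real \<Rightarrow> 'a set set \<Rightarrow> 'a measure \<Rightarrow> ('a \<Rightarrow> 'b::{real_normed_field, banach, second_countable_topology})
    \<Rightarrow> bool" where
  "paraproduct_compact p D \<mu> b \<longleftrightarrow>
    (\<exists>T. (\<forall>f\<in>Lp p \<mu>. paraproduct_converges_to p D \<mu> b f (T f)) \<and> compact_operator_Lp p \<mu> T)"

definition BMO ::
  "real \<Rightarrow> 'a::topological_space set set \<Rightarrow> 'a measure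
    \<Rightarrow> ('a \<Rightarrow> 'b::{real_normed_field, banach, second_countable_topology}) set" where
  "BMO p D \<mu> = {b \<in> L1_loc \<mu>. (SUP Q\<in>D. osc p \<mu> b Q) < \<infinity>}"

definition VMO ::
  "real \<Rightarrow> 'a::real_normed_vector set set \<Rightarrow> 'a measure
    \<Rightarrow> ('a \<Rightarrow> 'b::{real_normed_field, banach, second_countable_topology}) set" where
  "VMO p D \<mu> = {b \<in> BMO p D \<mu>.
    ((\<lambda>M::real. SUP Q\<in>{Q\<in>D. emeasure \<mu> Q \<ge> ennreal M}. osc p \<mu> b Q) \<longlongrightarrow> 0) at_top \<and>
    ((\<lambda>M::real. SUP Q\<in>{Q\<in>D. emeasure \<mu> Q \<le> ennreal (1 / M)}. osc p \<mu> b Q) \<longlongrightarrow> 0) at_top \<and>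
    ((\<lambda>M::real. SUP Q\<in>{Q\<in>D. infdist 0 Q \<ge> M}. osc p \<mu> b Q) \<longlongrightarrow> 0) at_top}"

end

theory Submission
  imports Defs
begin

text \<open>Test the operator on \<open>f\<^sub>Q = \<mu>(Q)\<^bsup>-1/p\<^esup> 1\<^sub>Q\<close>. Comparing averages over a cube \<open>R\<close> and its
  children \<open>P\<close>, only one term of the paraproduct \<open>T f\<close> survives:
  the average of \<open>T f\<close> changes from \<open>R\<close> to \<open>P\<close> by that of \<open>b\<close> times the average of \<open>f\<close> over \<open>R\<close>.
  A function is determined on \<open>Q\<close>, up to an additive constant, by these changes,
  so on \<open>Q\<close> the function \<open>b\<close> is \<open>\<mu>(Q)\<^bsup>1/p\<^esup> T f\<^sub>Q\<close> plus a constant, and the oscillation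
  of \<open>b\<close> on \<open>Q\<close> is controlled by the \<open>L\<^sup>p\<close> norm of \<open>1\<^sub>Q (T f\<^sub>Q - c)\<close> for every constant \<open>c\<close>.
  If the oscillation does not vanish along a sequence of cubes \<open>Q\<^sub>n\<close>, compactness gives a
  subsequential limit \<open>g\<close> of \<open>T f\<^sub>Q\<^sub>n\<close>. For light and distant cubes the \<open>L\<^sup>p\<close> norm of \<open>g\<close> over \<open>Q\<^sub>n\<close>
  tends to zero. For heavy cubes the averages of \<open>f\<^sub>Q\<^sub>n\<close> over any fixed cube tend to zero, so the
  averages of \<open>g\<close> do not change from a cube to its children, \<open>g\<close> is constant on every cube, and
  that constant serves as \<open>c\<close>.\<close>

section \<open>Dyadic cubes\<close>

lemma half_open_cube_subset_cbox: "half_open_cube a l \<subseteq> cbox a (\<chi> i. a $ i + l)"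
  by (auto simp: half_open_cube_def mem_box_cart less_imp_le)

lemma box_subset_half_open_cube: "box a (\<chi> i. a $ i + l) \<subseteq> half_open_cube a l"
  by (auto simp: half_open_cube_def mem_box_cart less_imp_le)

lemma corner_in_half_open_cube: "0 < l \<Longrightarrow> a \<in> half_open_cube a l"
  by (simp add: half_open_cube_def)

lemma half_open_cube_borel: "half_open_cube a l \<in> sets borel"
proof -
  have "half_open_cube a l = (\<Inter>i\<in>UNIV. {x. a $ i \<le> x $ i} \<inter> {x. x $ i < a $ i + l})"
    by (auto simp: half_open_cube_def)
  also have "\<dots> \<in> sets borel"
    by (intro sets.finite_INT sets.Int borel_closed borel_open closed_Collect_le open_Collect_less
        continuous_intros) auto
  finally show ?thesis .
qed

lemma half_open_cube_subset_iff:
  assumes "0 < l"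
  shows "half_open_cube a l \<subseteq> half_open_cube a' l' \<longleftrightarrow>
    (\<forall>i. a' $ i \<le> a $ i \<and> a $ i + l \<le> a' $ i + l')"
proof
  assume sub: "half_open_cube a l \<subseteq> half_open_cube a' l'"
  then have a: "a \<in> half_open_cube a' l'"
    using corner_in_half_open_cube[OF assms] by auto
  show "\<forall>i. a' $ i \<le> a $ i \<and> a $ i + l \<le> a' $ i + l'"
  proof (intro allI conjI)
    fix i
    show "a' $ i \<le> a $ i" using a by (simp add: half_open_cube_def)
    show "a $ i + l \<le> a' $ i + l'"
    proof (rule ccontr)
      assume "\<not> a $ i + l \<le> a' $ i + l'"
      moreover have "a $ i < a' $ i + l'" using a by (simp add: half_open_cube_def)
      \<comment> \<open>The witness is the corner \<open>a\<close> with coordinate \<open>i\<close>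
        moved to the upper endpoint of the larger cube, a value that the half-open interval
        excludes.\<close>
      ultimately have "(\<chi> j. if j = i then a' $ i + l' else a $ j) \<in> half_open_cube a l"
        using assms by (auto simp: half_open_cube_def)
      with sub have "(\<chi> j. if j = i then a' $ i + l' else a $ j) \<in> half_open_cube a' l'" ..
      then show False by (auto simp: half_open_cube_def dest: spec[of _ i])
    qed
  qed
next
  assume H: "\<forall>i. a' $ i \<le> a $ i \<and> a $ i + l \<le> a' $ i + l'"
  show "half_open_cube a l \<subseteq> half_open_cube a' l'"
  proof
    fix x assume x: "x \<in> half_open_cube a l"
    show "x \<in> half_open_cube a' l'"
      unfolding half_open_cube_def mem_Collect_eq
    proof
      fix i
      show "a' $ i \<le> x $ i \<and> x $ i < a' $ i + l'"
        using H[rule_format, of i] x[unfolded half_open_cube_def mem_Collect_eq, rule_format, of i]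
        by linarith
    qed
  qed
qed

text \<open>Turns chosen points into a counting bound: a disjoint family whose members have
  representatives in a finite or countable set is itself finite or countable.\<close>

lemma transversal_inj:
  assumes "disjoint \<P>" "\<And>P. P \<in> \<P> \<Longrightarrow> s P \<in> P"
  shows "inj_on s \<P>"
proof (rule inj_onI)
  fix P Q assume PQ: "P \<in> \<P>" "Q \<in> \<P>" "s P = s Q"
  then have "s P \<in> P \<inter> Q" using assms(2)[of P] assms(2)[of Q] by simp
  then show "P = Q" using assms(1) PQ unfolding disjoint_def by blast
qed

section \<open>Levels, nesting and children of dyadic cubes\<close>

locale dyadic_grid =
  fixes G :: "int \<Rightarrow> (real ^ 'd) set set"
  assumes grid_partition: "partition_on UNIV (G k)"
    and grid_cube: "Q \<in> G k \<Longrightarrow> \<exists>a. Q = half_open_cube a (2 powi (- k))"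
    and grid_refine: "P \<in> G (k + 1) \<Longrightarrow> \<exists>Q\<in>G k. P \<subseteq> Q"
begin

abbreviation "cubes \<equiv> (\<Union>k. G k)"

lemma cubeE:
  assumes "Q \<in> cubes" obtains k where "Q \<in> G k"
  using assms by auto

lemma grid_nonempty: "Q \<in> G k \<Longrightarrow> Q \<noteq> {}"
  using grid_partition by (metis partition_onD3)

lemma grid_disjoint: "disjoint (G k)"
  using grid_partition by (rule partition_onD2)

lemma grid_cover: obtains Q where "Q \<in> G k" "x \<in> Q"
proof -
  have "x \<in> \<Union>(G k)" using partition_onD1[OF grid_partition, of k] by simp
  then show ?thesis using that by auto
qed

lemma grid_unique: "P \<in> G k \<Longrightarrow> Q \<in> G k \<Longrightarrow> x \<in> P \<Longrightarrow> x \<in> Q \<Longrightarrow> P = Q"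
  using grid_disjoint[of k] by (auto simp: disjoint_def)

text \<open>Inclusion compares side lengths coordinatewise, and \<open>2 powi (- k)\<close>
  decreases in \<open>k\<close>, so a higher level means smaller cubes.\<close>

lemma grid_subset_level:
  assumes "P \<in> G k" "Q \<in> G j" "P \<subseteq> Q"
  shows "j \<le> k"
proof -
  obtain a a' where PQ: "P = half_open_cube a (2 powi (- k))" "Q = half_open_cube a' (2 powi (- j))"
    using grid_cube assms by metis
  have "(0::real) < 2 powi (- k)" by simp
  from half_open_cube_subset_iff[OF this, of a a' "2 powi (- j)"] assms(3)
  have "a' $ i \<le> a $ i \<and> a $ i + 2 powi (- k) \<le> a' $ i + 2 powi (- j)" for i
    unfolding PQ by blast
  \<comment> \<open>Any coordinate will do; \<open>undefined\<close> names one, as the index type is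
    inhabited.\<close>
  from this[of undefined] have "(2::real) powi (- k) \<le> 2 powi (- j)" by linarith
  then have "- k \<le> - j"
    using power_int_strict_increasing[of "- j" "- k" "2::real"] by (meson linorder_not_less one_less_numeral_iff semiring_norm(76))
  then show ?thesis by simp
qed

lemma grid_ancestor:
  assumes "j \<le> k" "P \<in> G k"
  shows "\<exists>Q\<in>G j. P \<subseteq> Q"
  using assms
proof (induction k arbitrary: P rule: int_ge_induct)
  case base then show ?case by auto
next
  case (step i)
  then obtain R where "R \<in> G i" "P \<subseteq> R" using grid_refine by blast
  with step show ?case by (meson order_trans)
qed

text \<open>Because each level is a partition, it suffices to compare \<open>Q\<close> with the
  ancestor of \<open>P\<close> at the level of \<open>Q\<close>.\<close>

lemma grid_nested:
  assumes "j \<le> k" "P \<in> G k" "Q \<in> G j"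
  shows "P \<subseteq> Q \<or> P \<inter> Q = {}"
proof -
  obtain R where R: "R \<in> G j" "P \<subseteq> R" using grid_ancestor[OF assms(1,2)] by blast
  show ?thesis
  proof (cases "R = Q")
    case True
    with R show ?thesis by simp
  next
    case False
    with R(1) assms(3) have "R \<inter> Q = {}"
      using grid_disjoint[of j] by (auto simp: disjoint_def)
    with R(2) show ?thesis by blast
  qed
qed

lemma grid_same_cube: "Q \<in> G k \<Longrightarrow> Q \<in> G j \<Longrightarrow> j = k"
  by (intro order_antisym grid_subset_level[OF _ _ subset_refl])

lemma cubes_nested: "P \<in> cubes \<Longrightarrow> Q \<in> cubes \<Longrightarrow> P \<subseteq> Q \<or> Q \<subseteq> P \<or> P \<inter> Q = {}"
proof -
  assume "P \<in> cubes" "Q \<in> cubes"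
  then obtain k j where "P \<in> G k" "Q \<in> G j" by blast
  then show ?thesis
    using grid_nested[of j k P Q] grid_nested[of k j Q P] by (cases "j \<le> k") auto
qed

lemma grid_subset_eq:
  assumes "P \<in> G k" "Q \<in> G k" "P \<subseteq> Q" shows "P = Q"
proof -
  obtain x where "x \<in> P" using grid_nonempty[OF assms(1)] by blast
  with assms show ?thesis using grid_unique[of P k Q x] by blast
qed

lemma strict_subcube_level:
  assumes "P \<in> G j" "Q \<in> G k" "P \<subset> Q"
  shows "k + 1 \<le> j"
proof -
  have "k \<le> j" using grid_subset_level[OF assms(1,2)] assms(3) by (simp add: less_le)
  moreover have "j \<noteq> k" using grid_subset_eq[of P k Q] assms by (auto simp: less_le)
  ultimately show ?thesis by simp
qed

lemma strict_subcube_ancestor: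
  assumes j: "A \<in> G j" and k: "Q \<in> G k" and sub: "A \<subset> Q"
  obtains P where "P \<in> G (k + 1)" "A \<subseteq> P" "P \<subseteq> Q"
proof -
  obtain R where R: "R \<in> G (k + 1)" "A \<subseteq> R"
    using grid_ancestor[OF strict_subcube_level[OF assms] j] by blast
  have "R \<inter> Q \<noteq> {}" using grid_nonempty[OF j] R(2) sub by blast
  then have "R \<subseteq> Q" using grid_nested[OF _ R(1) k] by simp
  with R that show ?thesis by blast
qed

text \<open>Levels cannot be skipped: a strict subcube lies inside an ancestor at level
  \<open>k + 1\<close>, which differs from \<open>Q\<close> and so, by maximality, is the subcube
  itself. Conversely, no level fits strictly between \<open>k\<close> and
  \<open>k + 1\<close>.\<close>

lemma dyadic_children_eq:
  assumes Q: "Q \<in> G k"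
  shows "dyadic_children cubes Q = {P \<in> G (k + 1). P \<subseteq> Q}"
proof (intro equalityI subsetI)
  fix P assume P: "P \<in> dyadic_children cubes Q"
  note P' = P[unfolded dyadic_children_def mem_Collect_eq]
  obtain j where j: "P \<in> G j" using P'[THEN conjunct1] by (rule cubeE)
  have sub: "P \<subset> Q" using P' by simp
  obtain R where R: "R \<in> G (k + 1)" "P \<subseteq> R" "R \<subseteq> Q"
    using strict_subcube_ancestor[OF j Q sub] .
  have "R \<noteq> Q" using grid_same_cube[OF Q, of "k + 1"] R(1) by auto
  have "P = R"
  proof (rule ccontr)
    assume "P \<noteq> R"
    then have "\<exists>R\<in>cubes. P \<subset> R \<and> R \<subset> Q"
      using R \<open>R \<noteq> Q\<close> by (intro bexI[of _ R]) auto
    then show False using P' by simp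
  qed
  then show "P \<in> {P \<in> G (k + 1). P \<subseteq> Q}" using R by simp
next
  fix P assume "P \<in> {P \<in> G (k + 1). P \<subseteq> Q}"
  then have P: "P \<in> G (k + 1)" "P \<subseteq> Q" by auto
  have "P \<noteq> Q" using grid_same_cube[OF Q, of "k + 1"] P(1) by auto
  moreover have False if R: "R \<in> cubes" "P \<subset> R" "R \<subset> Q" for R
  proof -
    obtain j where j: "R \<in> G j" using R(1) by (rule cubeE)
    have "j + 1 \<le> k + 1" "k + 1 \<le> j"
      using strict_subcube_level[OF P(1) j R(2)] strict_subcube_level[OF j Q R(3)] .
    then show False by simp
  qed
  ultimately show "P \<in> dyadic_children cubes Q"
    using P unfolding dyadic_children_def mem_Collect_eq less_le by blast
qed

text \<open>A child meets the \<open>2\<^sup>d\<close>-element set of points whose coordinates are those of the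
  corner or of the centre of the parent.\<close>
lemma finite_dyadic_children:
  assumes Q: "Q \<in> cubes"
  shows "finite (dyadic_children cubes Q)"
proof -
  obtain k where k: "Q \<in> G k" using Q by auto
  obtain a where a: "Q = half_open_cube a (2 powi (- k))" using grid_cube[OF k] by blast
  define l :: real where "l = 2 powi (- (k + 1))"
  have l: "0 < l" unfolding l_def by simp
  have l2: "2 powi (- k) = l + l"
    unfolding l_def using power_int_add_1[of "2::real" "- (k + 1)"] by simp
  define x where "x S = (\<chi> i. if i \<in> S then a $ i else a $ i + l)" for S
  have "\<exists>S. x S \<in> P" if P: "P \<in> {P \<in> G (k + 1). P \<subseteq> Q}" for P
  proof -
    obtain a' where a': "P = half_open_cube a' l" using grid_cube P unfolding l_def by blast
    have le: "a $ i \<le> a' $ i \<and> a' $ i \<le> a $ i + l" for i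
      using P half_open_cube_subset_iff[OF l, of a' a "l + l"] unfolding a a' l2 
      by (auto dest: spec[of _ i])
    \<comment> \<open>Where the corner of the child exceeds that of the parent, the centre
      coordinate \<open>a $ i + l\<close> is at least \<open>a' $ i\<close> and below
      \<open>a' $ i + l\<close>.\<close>
    have "x {i. a' $ i = a $ i} \<in> P"
      unfolding a' half_open_cube_def mem_Collect_eq
    proof
      fix i
      show "a' $ i \<le> x {i. a' $ i = a $ i} $ i \<and> x {i. a' $ i = a $ i} $ i < a' $ i + l"
        using le[of i] l by (simp add: x_def)
    qed
    then show ?thesis by blast
  qed
  then obtain s where s: "\<And>P. P \<in> {P \<in> G (k + 1). P \<subseteq> Q} \<Longrightarrow> x (s P) \<in> P" by metis
  have "disjoint {P \<in> G (k + 1). P \<subseteq> Q}"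
    using grid_disjoint[of "k + 1"] by (simp add: disjoint_def)
  then have "inj_on (\<lambda>P. x (s P)) {P \<in> G (k + 1). P \<subseteq> Q}"
    using s by (intro transversal_inj) auto
  moreover have "finite ((\<lambda>P. x (s P)) ` {P \<in> G (k + 1). P \<subseteq> Q})"
    by (rule finite_subset[of _ "range x"]) auto
  ultimately show ?thesis
    unfolding dyadic_children_eq[OF k] using finite_imageD by blast
qed

lemma dyadic_children_Union:
  assumes Q: "Q \<in> cubes"
  shows "\<Union>(dyadic_children cubes Q) = Q"
proof -
  obtain k where k: "Q \<in> G k" using Q by auto
  have "\<exists>P. P \<in> G (k + 1) \<and> P \<subseteq> Q \<and> x \<in> P" if "x \<in> Q" for x
  proof -
    obtain P where P: "P \<in> G (k + 1)" "x \<in> P" using grid_cover by blast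
    then show ?thesis using grid_nested[OF _ P(1) k] that by auto
  qed
  then show ?thesis unfolding dyadic_children_eq[OF k] by blast
qed

lemma dyadic_children_disjoint:
  assumes Q: "Q \<in> cubes"
  shows "disjoint (dyadic_children cubes Q)"
proof -
  obtain k where k: "Q \<in> G k" using Q by auto
  show ?thesis unfolding dyadic_children_eq[OF k]
    using grid_disjoint[of "k + 1"] by (simp add: disjoint_def)
qed

lemma strict_subcube_within_child:
  assumes Q: "Q \<in> cubes" and A: "A \<in> cubes" and sub: "A \<subset> Q"
  obtains P where "P \<in> dyadic_children cubes Q" "A \<subseteq> P"
proof -
  obtain k j where k: "Q \<in> G k" and j: "A \<in> G j" using Q A by blast
  from strict_subcube_ancestor[OF j k sub] obtain P
    where "P \<in> G (k + 1)" "A \<subseteq> P" "P \<subseteq> Q" .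
  then show ?thesis by (intro that[of P]) (simp_all add: dyadic_children_eq[OF k])
qed

section \<open>Countability of the cubes and generation of the Borel sets\<close>

text \<open>Each cube contains a nonempty open box and so a point of a countable dense set; within
  one level these points are distinct.\<close>

lemma countable_cubes: "countable cubes"
proof -
  obtain C :: "(real ^ 'd) set" where C: "countable C"
    and dense: "\<And>X. open X \<Longrightarrow> X \<noteq> {} \<Longrightarrow> \<exists>c\<in>C. c \<in> X"
    using countable_dense_setE by blast
  have "countable (G k)" for k
  proof -
    have "\<exists>c\<in>C. c \<in> P" if P: "P \<in> G k" for P
    proof -
      obtain a where a: "P = half_open_cube a (2 powi (- k))" using grid_cube[OF P] by blast
      have "box a (\<chi> i. a $ i + 2 powi (- k)) \<noteq> {}" by (simp add: interval_ne_empty_cart)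
      then show ?thesis using dense[OF open_box] box_subset_half_open_cube unfolding a by blast
    qed
    then obtain s where s: "\<And>P. P \<in> G k \<Longrightarrow> s P \<in> C \<and> s P \<in> P" by metis
    then have "inj_on s (G k)" using grid_disjoint by (intro transversal_inj) auto
    moreover have "countable (s ` G k)" using s by (intro countable_subset[OF _ C]) auto
    ultimately show ?thesis by (rule countable_image_inj_on[rotated])
  qed
  then show ?thesis by auto
qed

lemma cube_borel: assumes "Q \<in> cubes" shows "Q \<in> sets borel"
proof -
  obtain k where "Q \<in> G k" using assms by (rule cubeE)
  then obtain a where "Q = half_open_cube a (2 powi (- k))" using grid_cube by blast
  then show ?thesis by (simp add: half_open_cube_borel)
qed

lemma small_cube_within_open:
  assumes "open U" "x \<in> U"
  shows "\<exists>P\<in>cubes. x \<in> P \<and> P \<subseteq> U"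
proof -
  obtain e where e: "0 < e" "ball x e \<subseteq> U" using assms open_contains_ball by blast
  \<comment> \<open>The side length is taken below \<open>e\<close> over the dimension because the
    norm is estimated by the sum of all coordinate differences.\<close>
  obtain n where n: "(1 / 2) ^ n < e / real CARD('d)"
    using real_arch_pow_inv[of "e / real CARD('d)" "1 / 2"] e by auto
  obtain P where P: "P \<in> G (int n)" "x \<in> P" using grid_cover by blast
  obtain a where a: "P = half_open_cube a (2 powi (- int n))" using grid_cube[OF P(1)] by blast
  have "y \<in> ball x e" if y: "y \<in> P" for y
  proof -
    have "norm (x - y) \<le> (\<Sum>i\<in>UNIV. \<bar>(x - y) $ i\<bar>)" by (rule norm_le_l1_cart)
    also have "\<dots> \<le> (\<Sum>i\<in>(UNIV::'d set). (1 / 2) ^ n)"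
    proof (rule sum_mono)
      fix i
      have "2 powi (- int n) = (1 / 2 :: real) ^ n"
        by (simp add: power_int_minus power_one_over inverse_eq_divide)
      then show "\<bar>(x - y) $ i\<bar> \<le> (1 / 2) ^ n"
        using y P(2) unfolding a half_open_cube_def by (auto simp: abs_le_iff dest!: spec[of _ i])
    qed
    also have "\<dots> < e" using n by (simp add: field_simps)
    finally show ?thesis by (simp add: dist_norm)
  qed
  then show ?thesis using P e by (intro bexI[of _ P]) auto
qed

text \<open>An open set is the union of the cubes inside it, and countability makes this union
  admissible in the sigma-algebra.\<close>

lemma borel_eq_sigma_cubes: "sets borel = sigma_sets UNIV cubes"
proof
  have "U \<in> sigma_sets UNIV cubes" if "open U" for U
  proof -
    have "U = \<Union>{P \<in> cubes. P \<subseteq> U}"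
    proof (intro equalityI subsetI)
      fix x assume "x \<in> U"
      from small_cube_within_open[OF that this] obtain P where "P \<in> cubes" "x \<in> P" "P \<subseteq> U"
        by (elim bexE conjE)
      then show "x \<in> \<Union>{P \<in> cubes. P \<subseteq> U}" by (intro UnionI[of P] CollectI conjI)
    qed auto
    moreover have "countable {P \<in> cubes. P \<subseteq> U}"
      by (rule countable_subset[OF _ countable_cubes]) auto
    then have "\<Union>{P \<in> cubes. P \<subseteq> U} \<in> sigma_sets UNIV cubes"
      by (rule sigma_sets_UNION) auto
    ultimately show ?thesis by simp
  qed
  then show "sets borel \<subseteq> sigma_sets UNIV cubes"
    unfolding borel_def using sigma_sets_mono[of "Collect open" UNIV cubes] by auto
  show "sigma_sets UNIV cubes \<subseteq> sets borel"
    using sets.sigma_sets_subset[of cubes borel] cube_borel by auto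
qed

end

section \<open>Elementary $L^p$ estimates\<close>

text \<open>Beyond the threshold \<open>e\<close> the factor \<open>(t / e) powr (p - 1)\<close> is
  at least 1, and this factor times \<open>t\<close> is the second summand.\<close>

lemma le_plus_powr:
  fixes t :: real
  assumes "1 < p" "0 < e" "0 \<le> t"
  shows "t \<le> e + e powr (1 - p) * t powr p"
proof (cases "t \<le> e")
  case True
  have "0 \<le> e powr (1 - p) * t powr p" by simp
  with True show ?thesis by linarith
next
  case False
  then have t: "e < t" "0 < t" using assms by auto
  have "t powr p = t * t powr (p - 1)" using t by (simp add: powr_diff)
  moreover have "e powr (1 - p) * e powr (p - 1) = 1"
    using assms by (simp flip: powr_add)
  moreover have "e powr (p - 1) \<le> t powr (p - 1)"
    using assms t by (intro powr_mono2) auto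
  then have "e powr (1 - p) * e powr (p - 1) * t \<le> e powr (1 - p) * t powr (p - 1) * t"
    using t by (intro mult_right_mono mult_left_mono) auto
  ultimately have "t \<le> e powr (1 - p) * t powr p" by (simp add: mult_ac)
  then show ?thesis using assms by linarith
qed

lemma powr_add_le:
  fixes a b :: real
  assumes "0 < p" "0 \<le> a" "0 \<le> b"
  shows "(a + b) powr p \<le> 2 powr p * (a powr p + b powr p)"
proof -
  have "(a + b) powr p \<le> (2 * max a b) powr p"
    using assms by (intro powr_mono2) auto
  also have "\<dots> = 2 powr p * max a b powr p" using assms by (simp add: powr_mult)
  also have "\<dots> \<le> 2 powr p * (a powr p + b powr p)"
    by (intro mult_left_mono) (auto simp: max_def)
  finally show ?thesis .
qed

text \<open>Lets the estimates be carried out on \<open>p\<close>-th powers, so that roots of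
  extended reals disappear from the later arguments.\<close>

lemma ennreal_powr_le_iff:
  assumes "0 < p" "0 \<le> e"
  shows "ennreal_powr X (1 / p) \<le> ennreal e \<longleftrightarrow> X \<le> ennreal (e powr p)"
proof (cases X)
  case (real x)
  have "x powr (1 / p) \<le> e \<longleftrightarrow> x \<le> e powr p"
  proof
    assume "x powr (1 / p) \<le> e"
    then have "(x powr (1 / p)) powr p \<le> e powr p" using assms by (intro powr_mono2) auto
    then show "x \<le> e powr p" using assms real by (simp add: powr_powr)
  next
    assume "x \<le> e powr p"
    then have "x powr (1 / p) \<le> (e powr p) powr (1 / p)" using assms real by (intro powr_mono2) auto
    then show "x powr (1 / p) \<le> e" using assms by (simp add: powr_powr)
  qed
  then show ?thesis using real assms by (simp add: ennreal_powr_def)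
next
  case top
  then show ?thesis by (simp add: ennreal_powr_def top_unique)
qed

lemma Lp_norm_le_iff:
  assumes "0 < p" "0 \<le> e"
  shows "Lp_norm p M v \<le> ennreal e \<longleftrightarrow> (\<integral>\<^sup>+x. ennreal (norm (v x) powr p) \<partial>M) \<le> ennreal (e powr p)"
  unfolding Lp_norm_def using assms by (rule ennreal_powr_le_iff)

lemma Lp_nn_integral_finite:
  assumes "0 < p" "v \<in> Lp p M"
  shows "(\<integral>\<^sup>+x. ennreal (norm (v x) powr p) \<partial>M) < \<infinity>"
proof -
  have "Lp_norm p M v < \<infinity>" using assms by (simp add: Lp_def)
  then obtain e where e: "0 \<le> e" "Lp_norm p M v = ennreal e" by (cases "Lp_norm p M v") auto
  then show ?thesis
    using Lp_norm_le_iff[of p e M v] assms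
    by (metis ennreal_less_top infinity_ennreal_def order_le_less_trans order_refl)
qed

lemma nn_integral_tendsto_0_of_Lp_norm:
  assumes "0 < p" and lim: "((\<lambda>i. Lp_norm p M (v i)) \<longlongrightarrow> 0) F"
  shows "((\<lambda>i. \<integral>\<^sup>+x. ennreal (norm (v i x) powr p) \<partial>M) \<longlongrightarrow> 0) F"
proof (rule order_tendstoI)
  fix y :: ennreal assume y: "0 < y"
  \<comment> \<open>Truncation at 1 makes the threshold finite even if \<open>y\<close> is infinite;
    halving it below supplies the strict inequality.\<close>
  define r where "r = enn2real (min y 1)"
  have r: "ennreal r = min y 1" unfolding r_def
    by (intro ennreal_enn2real) (simp add: min_less_iff_disj)
  have "0 < r" using y r by (metis ennreal_less_zero_iff min_less_iff_conj zero_less_one)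
  have "0 < ennreal ((r / 2) powr (1 / p))" using \<open>0 < r\<close> by simp
  from order_tendstoD(2)[OF lim this]
  show "\<forall>\<^sub>F i in F. (\<integral>\<^sup>+x. ennreal (norm (v i x) powr p) \<partial>M) < y"
  proof eventually_elim
    case (elim i)
    then have "(\<integral>\<^sup>+x. ennreal (norm (v i x) powr p) \<partial>M) \<le> ennreal (((r / 2) powr (1 / p)) powr p)"
      using assms(1) by (subst Lp_norm_le_iff[symmetric]) (auto intro: less_imp_le)
    also have "\<dots> = ennreal (r / 2)" using assms \<open>0 < r\<close> by (simp add: powr_powr)
    also have "\<dots> < ennreal r" using \<open>0 < r\<close> by (simp add: ennreal_lessI)
    also have "\<dots> \<le> y" by (simp add: r)
    finally show ?case .
  qed
qed simp

text \<open>Splitting \<open>t \<le> e + e powr (1 - p) * t powr p\<close> replaces Hoelder's inequality throughout.\<close>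
lemma
  fixes v :: "'a \<Rightarrow> 'b::{banach, second_countable_topology}"
  assumes p: "1 < p" and A[measurable]: "A \<in> sets M" and fin: "emeasure M A < \<infinity>"
    and v[measurable]: "v \<in> borel_measurable M" and e: "0 < e" and m: "0 \<le> m"
    and le: "(\<integral>\<^sup>+x\<in>A. ennreal (norm (v x) powr p) \<partial>M) \<le> ennreal (e powr p * m)"
  shows set_integrable_of_nn_integral_powr: "set_integrable M A v"
    and norm_set_integral_le_powr: "norm (LINT x:A|M. v x) \<le> e * (measure M A + m)"
proof -
  have "(\<integral>\<^sup>+x. ennreal (norm (indicator A x *\<^sub>R v x)) \<partial>M)
      \<le> (\<integral>\<^sup>+x. ennreal e * indicator A x
            + ennreal (e powr (1 - p)) * (ennreal (norm (v x) powr p) * indicator A x) \<partial>M)"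
  proof (rule nn_integral_mono)
    fix x
    have "ennreal (norm (v x)) \<le> ennreal (e + e powr (1 - p) * norm (v x) powr p)"
      by (intro ennreal_leI le_plus_powr p e) simp
    then show "ennreal (norm (indicator A x *\<^sub>R v x)) \<le> ennreal e * indicator A x
        + ennreal (e powr (1 - p)) * (ennreal (norm (v x) powr p) * indicator A x)"
      using e by (auto simp: indicator_def ennreal_mult)
  qed
  also have "\<dots> = ennreal e * emeasure M A
      + ennreal (e powr (1 - p)) * (\<integral>\<^sup>+x\<in>A. ennreal (norm (v x) powr p) \<partial>M)"
    by (subst nn_integral_add) (auto simp: nn_integral_cmult)
  also have "\<dots> \<le> ennreal e * ennreal (measure M A) + ennreal (e powr (1 - p)) * ennreal (e powr p * m)"
    using le fin by (intro add_mono mult_left_mono) (auto simp: emeasure_eq_ennreal_measure)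
  also have "\<dots> = ennreal (e * measure M A + e powr (1 - p) * (e powr p * m))"
    using e m by (simp add: ennreal_mult)
  \<comment> \<open>The factor \<open>e powr p\<close> in the hypothesis is there to make both
    contributions linear in \<open>e\<close>.\<close>
  also have "e powr (1 - p) * (e powr p * m) = e * m"
    using e by (simp flip: mult.assoc powr_add)
  finally have bound: "(\<integral>\<^sup>+x. ennreal (norm (indicator A x *\<^sub>R v x)) \<partial>M) \<le> ennreal (e * (measure M A + m))"
    by (simp add: algebra_simps)
  show int: "set_integrable M A v"
    unfolding set_integrable_def
    by (rule integrableI_bounded) (use bound in \<open>auto simp: order_le_less_trans\<close>)
  have "ennreal (norm (LINT x:A|M. v x)) \<le> ennreal (e * (measure M A + m))"
    unfolding set_lebesgue_integral_def
    using integral_norm_bound_ennreal[OF int[unfolded set_integrable_def]] bound by (rule order_trans)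
  then show "norm (LINT x:A|M. v x) \<le> e * (measure M A + m)"
    using e m by (simp add: ennreal_le_iff)
qed

lemma Lp_set_integrable:
  fixes v :: "'a \<Rightarrow> 'b::{banach, second_countable_topology}"
  assumes "1 < p" "A \<in> sets M" "emeasure M A < \<infinity>" "v \<in> Lp p M"
  shows "set_integrable M A v"
proof -
  define m where "m = enn2real (\<integral>\<^sup>+x. ennreal (norm (v x) powr p) \<partial>M)"
  have "(\<integral>\<^sup>+x\<in>A. ennreal (norm (v x) powr p) \<partial>M) \<le> (\<integral>\<^sup>+x. ennreal (norm (v x) powr p) \<partial>M)"
    by (intro nn_integral_mono) (auto simp: indicator_def)
  also have "\<dots> = ennreal (1 powr p * m)"
    using Lp_nn_integral_finite[OF _ assms(4)] assms(1) by (simp add: m_def)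
  finally show ?thesis
    using assms by (intro set_integrable_of_nn_integral_powr[where e = 1 and m = m]) (auto simp: Lp_def m_def)
qed

section \<open>Averages\<close>

lemma average_diff:
  assumes "set_integrable M A u" "set_integrable M A v"
  shows "average M A (\<lambda>x. u x - v x) = average M A u - average M A v"
  using assms by (simp add: average_def scaleR_diff_right)

lemma average_sum:
  assumes "finite F" "\<And>i. i \<in> F \<Longrightarrow> set_integrable M A (u i)"
  shows "average M A (\<lambda>x. \<Sum>i\<in>F. u i x) = (\<Sum>i\<in>F. average M A (u i))"
proof -
  have "(LINT x:A|M. (\<Sum>i\<in>F. u i x)) = (\<Sum>i\<in>F. LINT x:A|M. u i x)"
    using assms unfolding set_lebesgue_integral_def set_integrable_def scaleR_sum_right
    by (intro Bochner_Integration.integral_sum)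
  then show ?thesis by (simp add: average_def scaleR_sum_right)
qed

lemma average_cmult:
  assumes "set_integrable M A u"
  shows "average M A (\<lambda>x. c * u x) = c * average M A u"
  using assms by (simp add: average_def)

text \<open>On a null set both sides are 0, so the identity holds without the case distinction in
  \<open>average\<close>.\<close>

lemma set_integral_eq_average:
  assumes "A \<in> sets M" "emeasure M A < \<infinity>"
  shows "(LINT x:A|M. u x) = measure M A *\<^sub>R average M A u"
proof (cases "emeasure M A = 0")
  case True
  have "AE x in M. x \<notin> A" using True assms by (intro AE_not_in null_setsI)
  then have "AE x in M. indicator A x *\<^sub>R u x = 0" by eventually_elim simp
  then have "(LINT x:A|M. u x) = 0"
    unfolding set_lebesgue_integral_def by (rule integral_eq_zero_AE)
  with True show ?thesis by (simp add: average_def)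
next
  case False
  then have "measure M A \<noteq> 0" using assms by (simp add: measure_def enn2real_eq_0_iff)
  with False show ?thesis by (simp add: average_def)
qed

lemma average_const_on:
  assumes "A \<in> sets M" "0 < emeasure M A" "emeasure M A < \<infinity>" "\<And>x. x \<in> A \<Longrightarrow> u x = c"
  shows "average M A u = c"
proof -
  have "(LINT x:A|M. u x) = (LINT x:A|M. c)"
    using assms by (intro set_lebesgue_integral_cong) auto
  then have "(LINT x:A|M. u x) = measure M A *\<^sub>R c"
    using assms by (simp add: set_integral_const)
  moreover have "measure M A \<noteq> 0" using assms by (auto simp: measure_def enn2real_eq_0_iff)
  ultimately show ?thesis using assms by (simp add: average_def)
qed

text \<open>\<open>norm_set_integral_le_powr\<close> with \<open>m = 1\<close> turns smallness of
  the \<open>L^p\<close> norm into smallness of the integral over \<open>A\<close>. The filter is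
  arbitrary, as both the net of partial sums and sequences occur below.\<close>

lemma average_tendsto:
  fixes u :: "'i \<Rightarrow> 'a \<Rightarrow> 'b::{real_normed_field, banach, second_countable_topology}"
  assumes p: "1 < p" and A: "A \<in> sets M" "emeasure M A < \<infinity>"
    and u: "\<forall>\<^sub>F i in F. u i \<in> borel_measurable M \<and> set_integrable M A (u i)"
    and g: "g \<in> Lp p M"
    and lim: "((\<lambda>i. Lp_norm p M (\<lambda>x. u i x - g x)) \<longlongrightarrow> 0) F"
  shows "((\<lambda>i. average M A (u i)) \<longlongrightarrow> average M A g) F"
proof (rule tendstoI)
  fix e :: real assume e: "0 < e"
  \<comment> \<open>Chosen so that \<open>r * (measure M A + 1)\<close> is
    \<open>e * measure M A / 2\<close>; on a null set both averages are 0 and any positive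
    \<open>r\<close> serves.\<close>
  define r where "r = (if emeasure M A = 0 then 1 else e * measure M A / (measure M A + 1) / 2)"
  have "0 < measure M A" if "emeasure M A \<noteq> 0"
    using that A by (simp add: measure_def enn2real_positive_iff zero_less_iff_neq_zero)
  then have r: "0 < r" using e by (auto simp: r_def)
  have gm: "g \<in> borel_measurable M" using g by (simp add: Lp_def)
  have "0 < ennreal r" using r by simp
  from order_tendstoD(2)[OF lim this] u
  show "\<forall>\<^sub>F i in F. dist (average M A (u i)) (average M A g) < e"
  proof eventually_elim
    case (elim i)
    have "(\<integral>\<^sup>+x\<in>A. ennreal (norm (u i x - g x) powr p) \<partial>M) \<le> (\<integral>\<^sup>+x. ennreal (norm (u i x - g x) powr p) \<partial>M)"
      by (intro nn_integral_mono) (auto simp: indicator_def)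
    also have "\<dots> \<le> ennreal (r powr p * 1)"
      using Lp_norm_le_iff[of p r M "\<lambda>x. u i x - g x"] p r elim by (simp add: less_imp_le)
    finally have "norm (LINT x:A|M. u i x - g x) \<le> r * (measure M A + 1)"
      using elim gm r by (intro norm_set_integral_le_powr[OF p A]) auto
    then have le: "norm (measure M A *\<^sub>R (average M A (u i) - average M A g)) \<le> r * (measure M A + 1)"
      using elim by (simp add: average_diff[OF _ Lp_set_integrable[OF p A g], symmetric]
          flip: set_integral_eq_average[OF A])
    show ?case
    proof (cases "emeasure M A = 0")
      case True
      then show ?thesis using e by (simp add: average_def)
    next
      case False
      then have m: "0 < measure M A" by fact
      have "r * (measure M A + 1) = e * measure M A / 2"
        using m False by (simp add: r_def field_simps add_pos_pos)
      with le have "measure M A * norm (average M A (u i) - average M A g) \<le> measure M A * (e / 2)"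
        by (simp add: mult_ac)
      then have "norm (average M A (u i) - average M A g) \<le> e / 2" using m by simp
      then show ?thesis using e by (simp add: dist_norm)
    qed
  qed
qed

lemma nn_integral_powr_minus_average_le:
  fixes u :: "'a \<Rightarrow> 'b::{real_normed_field, banach, second_countable_topology}"
  assumes p: "1 < p" and A[measurable]: "A \<in> sets M" and pos: "0 < emeasure M A"
    and fin: "emeasure M A < \<infinity>"
    and u[measurable]: "u \<in> borel_measurable M" and int: "set_integrable M A u"
  shows "(\<integral>\<^sup>+x\<in>A. ennreal (norm (u x - average M A u) powr p) \<partial>M)
    \<le> ennreal (2 powr p * (1 + 2 powr p)) * (\<integral>\<^sup>+x\<in>A. ennreal (norm (u x - c) powr p) \<partial>M)"
proof (cases "\<integral>\<^sup>+x\<in>A. ennreal (norm (u x - c) powr p) \<partial>M")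
  case top
  have "0 < 2 powr p * (1 + 2 powr p)" by (intro mult_pos_pos add_pos_nonneg) auto
  moreover have "ennreal K * top = top" if "0 < K" for K :: real
    using that by (simp add: ennreal_mult_top)
  ultimately have "ennreal (2 powr p * (1 + 2 powr p)) * top = top" by blast
  then show ?thesis by (simp only: top top_greatest)
next
  case (real j)
  define m where "m = measure M A"
  have m: "0 < m" using pos fin by (simp add: m_def measure_def enn2real_positive_iff)
  have em: "emeasure M A = ennreal m" using fin by (simp add: m_def emeasure_eq_ennreal_measure)
  define a where "a = average M A u - c"
  have c: "set_integrable M A (\<lambda>x. c)"
    using fin by (simp add: set_integrable_def)
  have avg: "m *\<^sub>R a = (LINT x:A|M. u x - c)"
    unfolding a_def m_def set_integral_eq_average[OF A fin]
    by (simp add: average_diff[OF int c] average_const_on[OF A pos fin])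
  have a_le: "norm a \<le> 2 * e" if e: "0 < e" "j \<le> e powr p * m" for e
  proof -
    have "norm (LINT x:A|M. u x - c) \<le> e * (measure M A + m)"
      using e m real
      by (intro norm_set_integral_le_powr[OF p A fin]) (auto intro!: ennreal_leI simp: real)
    then have "m * norm a \<le> m * (2 * e)"
      using m avg[symmetric] by (simp add: m_def algebra_simps)
    then show ?thesis using m by simp
  qed
  \<comment> \<open>The best \<open>e\<close> solves \<open>e powr p * m = j\<close>, which has a
    positive solution only if \<open>j\<close> is nonzero; for \<open>j = 0\<close> every positive
    \<open>e\<close> is admissible, so \<open>a\<close> vanishes.\<close>
  have jensen: "norm a powr p * m \<le> 2 powr p * j"
  proof (cases "j = 0")
    case True
    have "norm a \<le> 0"
    proof (rule field_le_epsilon)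
      fix e :: real assume "0 < e"
      then show "norm a \<le> 0 + e" using a_le[of "e / 2"] True m by simp
    qed
    then show ?thesis using True by simp
  next
    case False
    then have j: "0 < j" using real by simp
    define e where "e = (j / m) powr (1 / p)"
    have e: "0 < e" "e powr p = j / m" using j m p by (simp_all add: e_def powr_powr)
    then have "norm a \<le> 2 * e" using m by (intro a_le) auto
    then have "norm a powr p \<le> (2 * e) powr p" using p by (intro powr_mono2) auto
    then show ?thesis using e m by (simp add: powr_mult field_simps)
  qed
  have "(\<integral>\<^sup>+x\<in>A. ennreal (norm (u x - average M A u) powr p) \<partial>M)
    \<le> (\<integral>\<^sup>+x. ennreal (2 powr p) * (ennreal (norm (u x - c) powr p) * indicator A x)
        + ennreal (2 powr p * norm a powr p) * indicator A x \<partial>M)"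
  proof (rule nn_integral_mono)
    fix x
    have "norm (u x - average M A u) \<le> norm (u x - c) + norm a"
      unfolding a_def using norm_triangle_ineq4[of "u x - c" "average M A u - c"] by simp
    then have "norm (u x - average M A u) powr p \<le> (norm (u x - c) + norm a) powr p"
      using p by (intro powr_mono2) auto
    also have "\<dots> \<le> 2 powr p * (norm (u x - c) powr p + norm a powr p)"
      using p by (intro powr_add_le) auto
    finally have "ennreal (norm (u x - average M A u) powr p)
        \<le> ennreal (2 powr p) * ennreal (norm (u x - c) powr p) + ennreal (2 powr p * norm a powr p)"
      by (simp add: ennreal_leI distrib_left flip: ennreal_mult ennreal_plus)
    then show "ennreal (norm (u x - average M A u) powr p) * indicator A x
        \<le> ennreal (2 powr p) * (ennreal (norm (u x - c) powr p) * indicator A x)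
          + ennreal (2 powr p * norm a powr p) * indicator A x"
      by (auto simp: indicator_def)
  qed
  also have "\<dots> = ennreal (2 powr p) * ennreal j + ennreal (2 powr p * norm a powr p) * ennreal m"
    by (subst nn_integral_add) (auto simp: nn_integral_cmult real em)
  also have "\<dots> = ennreal (2 powr p * j + 2 powr p * (norm a powr p * m))"
    using real m by (simp add: mult.assoc flip: ennreal_mult ennreal_plus)
  also have "\<dots> \<le> ennreal (2 powr p * j + 2 powr p * (2 powr p * j))"
    using jensen by (intro ennreal_leI add_left_mono mult_left_mono) auto
  also have "\<dots> = ennreal (2 powr p * (1 + 2 powr p)) * ennreal j"
    using real by (simp add: algebra_simps flip: ennreal_mult)
  finally show ?thesis by (simp add: real)
qed

section \<open>Dyadic averages determine a function\<close>

locale dyadic_measure = dyadic_grid G for G :: "int \<Rightarrow> (real ^ 'd) set set" +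
  fixes \<mu> :: "(real ^ 'd) measure"
  assumes locally_finite: "locally_finite_borel_measure \<mu>"
begin

lemma sets_measure [measurable_cong]: "sets \<mu> = sets borel"
  using locally_finite by (simp add: locally_finite_borel_measure_def)

lemma space_measure: "space \<mu> = UNIV"
  using sets_eq_imp_space_eq[OF sets_measure] by simp

lemma cube_sets: "Q \<in> cubes \<Longrightarrow> Q \<in> sets \<mu>"
  using cube_borel by (simp only: sets_measure)

lemma cube_subset_compact:
  assumes "Q \<in> cubes" obtains K where "compact K" "Q \<subseteq> K"
proof -
  obtain k where "Q \<in> G k" using assms by (rule cubeE)
  then obtain a where "Q = half_open_cube a (2 powi (- k))" using grid_cube by blast
  with half_open_cube_subset_cbox have "Q \<subseteq> cbox a (\<chi> i. a $ i + 2 powi (- k))" by simp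
  then show ?thesis by (rule that[OF compact_cbox])
qed

lemma emeasure_compact_finite:
  assumes "compact K"
  shows "emeasure \<mu> K < \<infinity>"
proof -
  obtain U where U: "\<And>x. open (U x)" "\<And>x. x \<in> U x" "\<And>x. emeasure \<mu> (U x) < \<infinity>"
    using locally_finite unfolding locally_finite_borel_measure_def by metis
  have "K \<subseteq> (\<Union>x\<in>K. U x)" using U(2) by auto
  then obtain C where C: "C \<subseteq> K" "finite C" "K \<subseteq> (\<Union>x\<in>C. U x)"
    using compactE_image[OF assms, of K U] U(1) by metis
  have meas: "U ` C \<subseteq> sets \<mu>" using U(1) by (auto simp: sets_measure)
  have "emeasure \<mu> K \<le> emeasure \<mu> (\<Union>x\<in>C. U x)"
    using C meas by (intro emeasure_mono) auto
  also have "\<dots> \<le> (\<Sum>x\<in>C. emeasure \<mu> (U x))"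
    using C meas by (intro emeasure_subadditive_finite) auto
  also have "\<dots> < \<infinity>" using U(3) C(2) by (simp add: ennreal_sum_less_top)
  finally show ?thesis .
qed

lemma cube_finite:
  assumes "Q \<in> cubes" shows "emeasure \<mu> Q < \<infinity>"
proof -
  obtain K where K: "compact K" "Q \<subseteq> K" using assms by (rule cube_subset_compact)
  then have "emeasure \<mu> Q \<le> emeasure \<mu> K"
    by (intro emeasure_mono) (auto simp: sets_measure intro: borel_compact)
  then show ?thesis using emeasure_compact_finite[OF K(1)] by (rule order_le_less_trans)
qed

lemma cube_emeasure: "Q \<in> cubes \<Longrightarrow> emeasure \<mu> Q = ennreal (measure \<mu> Q)"
  using cube_finite[of Q] by (simp add: emeasure_eq_ennreal_measure less_top[symmetric])

lemma subcube_pos: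
  "A \<in> cubes \<Longrightarrow> B \<in> cubes \<Longrightarrow> A \<subseteq> B \<Longrightarrow> 0 < emeasure \<mu> A \<Longrightarrow> 0 < emeasure \<mu> B"
  using emeasure_mono[of A B \<mu>] cube_sets[of B] by (metis order_less_le_trans)

lemma L1_loc_integrable_cube:
  assumes "b \<in> L1_loc \<mu>" "Q \<in> cubes"
  shows "set_integrable \<mu> Q b"
proof -
  obtain K where K: "compact K" "Q \<subseteq> K" using assms(2) by (rule cube_subset_compact)
  then have "set_integrable \<mu> K b" using assms(1) by (simp add: L1_loc_def)
  then show ?thesis using cube_sets[OF assms(2)] K(2) by (rule set_integrable_subset)
qed

lemma L1_loc_measurable: "b \<in> L1_loc \<mu> \<Longrightarrow> b \<in> borel_measurable \<mu>"
  by (simp add: L1_loc_def)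

lemma sigma_finite: "sigma_finite_measure \<mu>"
proof
  have "\<Union>cubes = UNIV"
  proof (intro equalityI subsetI)
    fix x :: "real ^ 'd"
    obtain Q where "Q \<in> G 0" "x \<in> Q" by (rule grid_cover)
    then show "x \<in> \<Union>cubes" by (intro UnionI[of Q]) auto
  qed simp
  then show "\<exists>A. countable A \<and> A \<subseteq> sets \<mu> \<and> \<Union>A = space \<mu> \<and> (\<forall>a\<in>A. emeasure \<mu> a \<noteq> \<infinity>)"
    using countable_cubes cube_sets cube_finite space_measure
    by (intro exI[of _ cubes] conjI ballI subsetI) (auto simp: less_top[symmetric] dest!: cube_finite)
qed

text \<open>Cubes and the empty set form an intersection-stable generator of the Borel sets, and the
  sets whose part in \<open>Q\<close> carries zero integral are closed under complements and
  countable disjoint unions. So all integrals over Borel parts of \<open>Q\<close> vanish, which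
  forces \<open>h\<close> to vanish almost everywhere on \<open>Q\<close>.\<close>

lemma AE_zero_of_cube_integrals_zero:
  fixes h :: "real ^ 'd \<Rightarrow> 'b::{banach, second_countable_topology}"
  assumes Q: "Q \<in> cubes" and int: "set_integrable \<mu> Q h"
    and zero: "\<And>P. P \<in> cubes \<Longrightarrow> P \<subseteq> Q \<Longrightarrow> (LINT x:P|\<mu>. h x) = 0"
  shows "AE x\<in>Q in \<mu>. h x = 0"
proof -
  note Qs = cube_sets[OF Q]
  \<comment> \<open>The empty set is adjoined because it is the intersection of disjoint cubes, yet
    not a cube.\<close>
  have sub: "sigma_sets UNIV cubes \<subseteq> sigma_sets UNIV (insert {} cubes)"
    by (intro sigma_sets_subseteq) auto
  have eq: "sigma_sets UNIV (insert {} cubes) = sets borel"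
  proof
    show "sigma_sets UNIV (insert {} cubes) \<subseteq> sets borel"
      using sets.sigma_sets_subset[of "insert {} cubes" borel] cube_borel by simp blast
    show "sets borel \<subseteq> sigma_sets UNIV (insert {} cubes)"
      using sub unfolding borel_eq_sigma_cubes .
  qed
  have stable: "Int_stable (insert {} cubes)"
  proof (rule Int_stableI)
    fix A B assume "A \<in> insert {} cubes" "B \<in> insert {} cubes"
    then consider "A = {} \<or> B = {}" | "A \<in> cubes" "B \<in> cubes" by blast
    then show "A \<inter> B \<in> insert {} cubes"
    proof cases
      case 2
      then consider "A \<subseteq> B" | "B \<subseteq> A" | "A \<inter> B = {}" using cubes_nested by blast
      then show ?thesis using 2 by cases (simp_all only: Int_absorb1 Int_absorb2 insert_iff simp_thms)
    qed auto
  qed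
  have subset_Pow: "insert {} cubes \<subseteq> Pow UNIV" by simp
  have "(LINT x:A \<inter> Q|\<mu>. h x) = 0" if "A \<in> sets borel" for A
    using stable subset_Pow that[folded eq]
  proof (induction rule: sigma_sets_induct_disjoint)
    case (basic A)
    then consider "A = {}" | "A \<in> cubes" by blast
    then show ?case
    proof cases
      case 2
      then consider "A \<subseteq> Q" | "Q \<subseteq> A" | "A \<inter> Q = {}" using cubes_nested[OF _ Q] by blast
      then show ?thesis
        using zero[OF 2] zero[OF Q] by cases (simp_all add: Int_absorb1 Int_absorb2 set_lebesgue_integral_def)
    qed (simp add: set_lebesgue_integral_def)
  next
    case empty
    then show ?case by (simp add: set_lebesgue_integral_def)
  next
    case (compl A)
    have A: "A \<in> sets \<mu>" using compl(1) by (simp only: eq sets_measure)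
    have "(LINT x:((UNIV - A) \<inter> Q) \<union> (A \<inter> Q)|\<mu>. h x)
        = (LINT x:(UNIV - A) \<inter> Q|\<mu>. h x) + (LINT x:A \<inter> Q|\<mu>. h x)"
      using A Qs space_measure
      by (intro set_integral_Un set_integrable_subset[OF int]) (auto simp: Int_commute Diff_Int_distrib)
    moreover have "((UNIV - A) \<inter> Q) \<union> (A \<inter> Q) = Q" by blast
    ultimately show ?case using compl(2) zero[OF Q] by simp
  next
    case (union A)
    have A: "A i \<in> sets \<mu>" for i using union(2) by (auto simp: eq sets_measure)
    have "(LINT x:(\<Union>i. A i \<inter> Q)|\<mu>. h x) = (\<Sum>i. LINT x:A i \<inter> Q|\<mu>. h x)"
      using union(1) A Qs
      by (intro lebesgue_integral_countable_add set_integrable_subset[OF int])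
        (auto simp: disjoint_family_on_def)
    then show ?case using union(3) by simp
  qed
  then have null: "set_lebesgue_integral \<mu> A (\<lambda>x. indicator Q x *\<^sub>R h x) = 0" if "A \<in> sets \<mu>" for A
    using that by (simp add: sets_measure set_lebesgue_integral_def indicator_inter_arith)
  have "AE x in \<mu>. indicator Q x *\<^sub>R h x = 0"
    using int null unfolding set_integrable_def
    by (intro sigma_finite_measure.density_zero[OF sigma_finite])
  then show ?thesis by eventually_elim auto
qed

text \<open>Descending from \<open>Q\<close> level by level, the average never changes along cubes
  of positive measure, as the parent of such a cube has positive measure too. Subtracting the common
  average makes all integrals over subcubes zero, null cubes included.\<close>

lemma AE_const_of_child_averages_eq:
  fixes h :: "real ^ 'd \<Rightarrow> 'b::{real_normed_field, banach, second_countable_topology}"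
  assumes Q: "Q \<in> cubes" and int: "set_integrable \<mu> Q h"
    and step: "\<And>R P. R \<in> cubes \<Longrightarrow> R \<subseteq> Q \<Longrightarrow> P \<in> dyadic_children cubes R \<Longrightarrow> 0 < emeasure \<mu> P
      \<Longrightarrow> average \<mu> P h = average \<mu> R h"
  shows "\<exists>c. AE x\<in>Q in \<mu>. h x = c"
proof -
  define c where "c = average \<mu> Q h"
  obtain k where k: "Q \<in> G k" using Q by (rule cubeE)
  have avg: "P \<in> G j \<Longrightarrow> P \<subseteq> Q \<Longrightarrow> 0 < emeasure \<mu> P \<Longrightarrow> average \<mu> P h = c" if "k \<le> j" for j P
    using that
  proof (induction j arbitrary: P rule: int_ge_induct)
    case base
    then have "P = Q" using grid_subset_eq[OF _ k] by blast
    then show ?case by (simp add: c_def)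
  next
    case (step i)
    obtain R where R: "R \<in> G i" "P \<subseteq> R" using grid_refine step.prems(1) by blast
    have "R \<inter> Q \<noteq> {}" using grid_nonempty[OF step.prems(1)] step.prems(2) R(2) by blast
    then have RQ: "R \<subseteq> Q" using grid_nested[OF step.hyps R(1) k] by simp
    have Rc: "R \<in> cubes" and Pc: "P \<in> cubes" using R(1) step.prems(1) by auto
    have "P \<in> dyadic_children cubes R" using step.prems(1) R by (simp add: dyadic_children_eq)
    then have "average \<mu> P h = average \<mu> R h"
      using assms(3)[OF Rc RQ] step.prems(3) by blast
    then show ?case using step.IH[OF R(1) RQ] subcube_pos[OF Pc Rc R(2)] step.prems(3) by simp
  qed
  have "AE x\<in>Q in \<mu>. h x - c = 0"
  proof (rule AE_zero_of_cube_integrals_zero[OF Q])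
    have const: "set_integrable \<mu> P (\<lambda>x. c)" if "P \<in> cubes" for P
      using cube_finite[OF that] cube_sets[OF that] by (simp add: set_integrable_def)
    show "set_integrable \<mu> Q (\<lambda>x. h x - c)" using int const[OF Q] by simp
    fix P assume P: "P \<in> cubes" "P \<subseteq> Q"
    obtain j where j: "P \<in> G j" using P(1) by (rule cubeE)
    have kj: "k \<le> j" by (rule grid_subset_level[OF j k P(2)])
    note Ps = cube_sets[OF P(1)] cube_finite[OF P(1)]
    show "(LINT x:P|\<mu>. h x - c) = 0"
    proof (cases "emeasure \<mu> P = 0")
      case True
      then show ?thesis using set_integral_eq_average[OF Ps] by (simp add: measure_def)
    next
      case False
      then have pos: "0 < emeasure \<mu> P" by (simp add: zero_less_iff_neq_zero)
      have "average \<mu> P (\<lambda>x. h x - c) = c - c"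
        using average_diff[OF set_integrable_subset[OF int Ps(1) P(2)] const[OF P(1)]]
          avg[OF kj j P(2) pos] average_const_on[OF Ps(1) pos Ps(2), of "\<lambda>x. c" c] by simp
      then show ?thesis using set_integral_eq_average[OF Ps, of "\<lambda>x. h x - c"] by simp
    qed
  qed
  then show ?thesis by (intro exI[of _ c]) simp
qed

section \<open>Averages of the paraproduct\<close>

lemma child_cube: "P \<in> dyadic_children cubes R \<Longrightarrow> P \<in> cubes"
  and child_strict_subset: "P \<in> dyadic_children cubes R \<Longrightarrow> P \<subset> R"
  by (simp_all add: dyadic_children_def)

context
  fixes b :: "real ^ 'd \<Rightarrow> 'b::{real_normed_field, banach, second_countable_topology}"
  assumes b: "b \<in> L1_loc \<mu>"
begin

lemma dyadic_difference_on_child: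
  assumes S: "S \<in> cubes" and P: "P \<in> dyadic_children cubes S" and x: "x \<in> P"
  shows "dyadic_difference cubes \<mu> b S x = average \<mu> P b - average \<mu> S b"
proof -
  have "dyadic_difference cubes \<mu> b S x
      = (\<Sum>P'\<in>dyadic_children cubes S. if P' = P then average \<mu> P b - average \<mu> S b else 0)"
    unfolding dyadic_difference_def
  proof (intro sum.cong refl)
    fix P' assume P': "P' \<in> dyadic_children cubes S"
    have "x \<notin> P'" if "P' \<noteq> P"
      using dyadic_children_disjoint[OF S] P P' that x unfolding disjoint_def by blast
    then show "(average \<mu> P' b - average \<mu> S b) * indicator P' x
        = (if P' = P then average \<mu> P b - average \<mu> S b else 0)"
      using x by simp
  qed
  also have "\<dots> = average \<mu> P b - average \<mu> S b"
    using P by (simp add: finite_dyadic_children[OF S])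
  finally show ?thesis .
qed

lemma dyadic_difference_measurable: "dyadic_difference cubes \<mu> b S \<in> borel_measurable \<mu>"
proof -
  have "(\<lambda>x. \<Sum>P\<in>dyadic_children cubes S. (average \<mu> P b - average \<mu> S b) * indicator P x) \<in> borel_measurable \<mu>"
    using child_cube[THEN cube_sets]
    by (intro borel_measurable_sum borel_measurable_times borel_measurable_const borel_measurable_indicator)
  then show ?thesis unfolding dyadic_difference_def[abs_def] .
qed

lemma dyadic_difference_integrable:
  assumes "A \<in> cubes"
  shows "set_integrable \<mu> A (dyadic_difference cubes \<mu> b S)"
proof -
  have "norm (dyadic_difference cubes \<mu> b S x)
      \<le> (\<Sum>P\<in>dyadic_children cubes S. norm (average \<mu> P b - average \<mu> S b))" for x
    unfolding dyadic_difference_def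
    by (rule order_trans[OF norm_sum sum_mono]) (auto simp: norm_mult indicator_def)
  then show ?thesis
    unfolding set_integrable_def
    using cube_sets[OF assms] cube_finite[OF assms] dyadic_difference_measurable
    by (intro integrableI_bounded_set_indicator) auto
qed

text \<open>On each child the difference has the same integral as
  \<open>b x - average \<mu> S b\<close>, so summing over the children gives the integral over
  \<open>S\<close> of \<open>b\<close> minus its own average.\<close>

lemma set_integral_dyadic_difference:
  assumes S: "S \<in> cubes"
  shows "(LINT x:S|\<mu>. dyadic_difference cubes \<mu> b S x) = 0"
proof -
  define C where "C = dyadic_children cubes S"
  have fin: "finite C" and U: "(\<Union>P\<in>C. P) = S" and disj: "disjoint_family_on (\<lambda>P. P) C"
    using finite_dyadic_children[OF S] dyadic_children_Union[OF S] dyadic_children_disjoint[OF S]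
    by (auto simp: C_def disjoint_def disjoint_family_on_def)
  have const: "set_integrable \<mu> A (\<lambda>x. c)" if "A \<in> cubes" for A and c :: 'b
    using cube_finite[OF that] cube_sets[OF that] by (simp add: set_integrable_def)
  note bS = L1_loc_integrable_cube[OF b]
  have cu: "P \<in> cubes" if "P \<in> C" for P using that child_cube unfolding C_def by blast
  have "(LINT x:(\<Union>P\<in>C. P)|\<mu>. dyadic_difference cubes \<mu> b S x)
      = (\<Sum>P\<in>C. LINT x:P|\<mu>. dyadic_difference cubes \<mu> b S x)"
    using fin disj cu by (intro set_integral_finite_Union dyadic_difference_integrable cube_sets)
  also have "\<dots> = (\<Sum>P\<in>C. LINT x:P|\<mu>. b x - average \<mu> S b)"
  proof (rule sum.cong[OF refl])
    fix P assume P: "P \<in> C"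
    note Pc = cube_sets[OF cu[OF P]] cube_finite[OF cu[OF P]]
    have "(LINT x:P|\<mu>. dyadic_difference cubes \<mu> b S x) = (LINT x:P|\<mu>. average \<mu> P b - average \<mu> S b)"
      using Pc P dyadic_difference_on_child[OF S] by (intro set_lebesgue_integral_cong) (auto simp: C_def)
    also have "\<dots> = measure \<mu> P *\<^sub>R average \<mu> P b - measure \<mu> P *\<^sub>R average \<mu> S b"
      using Pc by (simp add: set_integral_const scaleR_diff_right)
    also have "\<dots> = (LINT x:P|\<mu>. b x - average \<mu> S b)"
      using Pc bS[OF cu[OF P]] const[OF cu[OF P]]
      by (simp add: set_integral_const set_integral_eq_average[symmetric])
    finally show "(LINT x:P|\<mu>. dyadic_difference cubes \<mu> b S x) = (LINT x:P|\<mu>. b x - average \<mu> S b)" .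
  qed
  also have "\<dots> = (LINT x:(\<Union>P\<in>C. P)|\<mu>. b x - average \<mu> S b)"
    using fin disj cu bS[OF cu] const[OF cu]
    by (intro set_integral_finite_Union[symmetric] cube_sets set_integral_diff)
  also have "\<dots> = measure \<mu> S *\<^sub>R average \<mu> S b - measure \<mu> S *\<^sub>R average \<mu> S b"
    unfolding U using cube_sets[OF S] cube_finite[OF S] bS[OF S] const[OF S]
    by (simp add: set_integral_const set_integral_eq_average[symmetric])
  finally show ?thesis unfolding U by simp
qed

lemma paraproduct_term_measurable:
  "S \<in> cubes \<Longrightarrow> (\<lambda>x. dyadic_difference cubes \<mu> b S x * c * indicator S x) \<in> borel_measurable \<mu>"
  using cube_sets dyadic_difference_measurable by measurable

lemma paraproduct_term_integrable:
  assumes "S \<in> cubes" "A \<in> cubes"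
  shows "set_integrable \<mu> A (\<lambda>x. dyadic_difference cubes \<mu> b S x * c * indicator S x)"
proof (rule set_integrable_bound)
  show "set_integrable \<mu> A (\<lambda>x. dyadic_difference cubes \<mu> b S x * c)"
    using dyadic_difference_integrable[OF assms(2)] by simp
  show "set_borel_measurable \<mu> A (\<lambda>x. dyadic_difference cubes \<mu> b S x * c * indicator S x)"
    unfolding set_borel_measurable_def
    using paraproduct_term_measurable[OF assms(1)] cube_sets[OF assms(2)]
    by (intro borel_measurable_scaleR borel_measurable_indicator) auto
qed (auto simp: indicator_def)

text \<open>The term has mean zero over any cube containing \<open>S\<close>, vanishes on cubes
  disjoint from \<open>S\<close>, and is constant on each child of \<open>S\<close>. Hence
  \<open>R\<close> and \<open>P\<close> have equal averages unless \<open>S = R\<close>, where the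
  average 0 over \<open>R\<close> meets the constant on \<open>P\<close>. Positive measure of
  \<open>P\<close> matters because averages over null cubes are 0 by convention.\<close>

lemma average_paraproduct_term_diff:
  fixes c :: 'b
  assumes R: "R \<in> cubes" and P: "P \<in> dyadic_children cubes R" and pos: "0 < emeasure \<mu> P"
    and S: "S \<in> cubes"
  defines "u \<equiv> (\<lambda>x. dyadic_difference cubes \<mu> b S x * c * indicator S x)"
  shows "average \<mu> P u - average \<mu> R u = (if S = R then (average \<mu> P b - average \<mu> R b) * c else 0)"
proof -
  note Pc = child_cube[OF P] and PR = child_strict_subset[OF P]
  have posR: "0 < emeasure \<mu> R" using subcube_pos[OF Pc R] PR pos by auto
  have inside: "average \<mu> A u = 0" if A: "S \<subseteq> A" for A
  proof -
    have "(LINT x:A|\<mu>. u x) = (LINT x:S|\<mu>. dyadic_difference cubes \<mu> b S x * c)"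
      unfolding set_lebesgue_integral_def u_def
      using A by (intro Bochner_Integration.integral_cong) (auto simp: indicator_def)
    also have "\<dots> = 0" using set_integral_dyadic_difference[OF S] by simp
    finally show ?thesis by (simp add: average_def)
  qed
  have outside: "average \<mu> A u = 0" if A: "A \<in> cubes" "0 < emeasure \<mu> A" "S \<inter> A = {}" for A
    using A cube_sets cube_finite by (intro average_const_on) (auto simp: u_def indicator_def)
  have within: "average \<mu> A u = (average \<mu> P' b - average \<mu> S b) * c"
    if "A \<in> cubes" "0 < emeasure \<mu> A" "P' \<in> dyadic_children cubes S" "A \<subseteq> P'" for A P'
    using that cube_sets cube_finite dyadic_difference_on_child[OF S that(3)] child_strict_subset[OF that(3)]
    by (intro average_const_on) (auto simp: u_def indicator_def)
  consider "S = R" | "S \<inter> R = {}" | "S \<subset> R" | "R \<subset> S" using cubes_nested[OF S R] by blast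
  then show ?thesis
  proof cases
    case 1
    then show ?thesis using inside[of R] within[OF Pc pos] P by simp
  next
    case 2
    then have "S \<inter> P = {}" "S \<noteq> R" using PR by auto
    then show ?thesis using 2 outside[OF R posR] outside[OF Pc pos] by simp
  next
    case 3
    obtain P' where P': "P' \<in> dyadic_children cubes R" "S \<subseteq> P'"
      using strict_subcube_within_child[OF R S 3] by blast
    have "S \<subseteq> P \<or> S \<inter> P = {}"
      using dyadic_children_disjoint[OF R] P P' unfolding disjoint_def by blast
    then have "average \<mu> P u = 0" using inside outside[OF Pc pos] by blast
    then show ?thesis using inside[of R] 3 by auto
  next
    case 4
    obtain P' where P': "P' \<in> dyadic_children cubes S" "R \<subseteq> P'"
      using strict_subcube_within_child[OF S R 4] by blast
    have "P \<subseteq> P'" using P'(2) PR by auto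
    then show ?thesis using within[OF R posR P'] within[OF Pc pos P'(1)] 4 by auto
  qed
qed

text \<open>Only the term of the cube \<open>R\<close> itself distinguishes \<open>R\<close> from its children on average.\<close>
lemma average_paraproduct_diff:
  assumes p: "1 < p" and conv: "paraproduct_converges_to p cubes \<mu> b f g"
    and R: "R \<in> cubes" and P: "P \<in> dyadic_children cubes R" and pos: "0 < emeasure \<mu> P"
  shows "average \<mu> P g - average \<mu> R g = (average \<mu> P b - average \<mu> R b) * average \<mu> R f"
proof -
  define u where "u S x = dyadic_difference cubes \<mu> b S x * average \<mu> S f * indicator S x" for S x
  let ?F = "finite_subsets_at_top cubes"
  have g: "g \<in> Lp p \<mu>" and lim: "((\<lambda>F. Lp_norm p \<mu> (\<lambda>x. (\<Sum>S\<in>F. u S x) - g x)) \<longlongrightarrow> 0) ?F"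
    using conv unfolding paraproduct_converges_to_def u_def by auto
  have ui: "set_integrable \<mu> A (u S)" if "S \<in> cubes" "A \<in> cubes" for A S
    using paraproduct_term_integrable[OF that] unfolding u_def[abs_def] .
  have um: "u S \<in> borel_measurable \<mu>" if "S \<in> cubes" for S
    using paraproduct_term_measurable[OF that] unfolding u_def[abs_def] .
  have tends: "((\<lambda>F. average \<mu> A (\<lambda>x. \<Sum>S\<in>F. u S x)) \<longlongrightarrow> average \<mu> A g) ?F" if A: "A \<in> cubes" for A
  proof (rule average_tendsto[OF p cube_sets[OF A] cube_finite[OF A] _ g lim])
    show "\<forall>\<^sub>F F in ?F. (\<lambda>x. \<Sum>S\<in>F. u S x) \<in> borel_measurable \<mu> \<and> set_integrable \<mu> A (\<lambda>x. \<Sum>S\<in>F. u S x)"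
    proof (rule eventually_finite_subsets_at_top_weakI)
      fix F assume F: "finite F" "F \<subseteq> cubes"
      have "set_integrable \<mu> A (\<lambda>x. \<Sum>S\<in>F. u S x)"
        unfolding set_integrable_def scaleR_sum_right
        using F ui[OF _ A] unfolding set_integrable_def by (intro Bochner_Integration.integrable_sum) blast
      then show "(\<lambda>x. \<Sum>S\<in>F. u S x) \<in> borel_measurable \<mu> \<and> set_integrable \<mu> A (\<lambda>x. \<Sum>S\<in>F. u S x)"
        using F um by (intro conjI borel_measurable_sum) blast+
    qed
  qed
  have "((\<lambda>F. average \<mu> P (\<lambda>x. \<Sum>S\<in>F. u S x) - average \<mu> R (\<lambda>x. \<Sum>S\<in>F. u S x))
      \<longlongrightarrow> average \<mu> P g - average \<mu> R g) ?F"
    by (intro tendsto_diff tends R child_cube[OF P])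
  \<comment> \<open>The net is constant from \<open>{R}\<close> on: every finite family containing
    \<open>R\<close> already gives the limit value.\<close>
  moreover have "((\<lambda>F. average \<mu> P (\<lambda>x. \<Sum>S\<in>F. u S x) - average \<mu> R (\<lambda>x. \<Sum>S\<in>F. u S x))
      \<longlongrightarrow> (average \<mu> P b - average \<mu> R b) * average \<mu> R f) ?F"
  proof (rule tendsto_eventually, unfold eventually_finite_subsets_at_top,
      intro exI[of _ "{R}"] conjI allI impI)
    fix F assume F: "finite F \<and> {R} \<subseteq> F \<and> F \<subseteq> cubes"
    have Fc: "S \<in> cubes" if "S \<in> F" for S using F that by blast
    have "average \<mu> A (\<lambda>x. \<Sum>S\<in>F. u S x) = (\<Sum>S\<in>F. average \<mu> A (u S))" if "A \<in> cubes" for A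
      using F by (intro average_sum ui Fc that) simp
    from this[OF R] this[OF child_cube[OF P]]
    have "average \<mu> P (\<lambda>x. \<Sum>S\<in>F. u S x) - average \<mu> R (\<lambda>x. \<Sum>S\<in>F. u S x)
        = (\<Sum>S\<in>F. average \<mu> P (u S) - average \<mu> R (u S))"
      by (simp only: sum_subtractf)
    also have "\<dots> = (\<Sum>S\<in>F. if S = R then (average \<mu> P b - average \<mu> R b) * average \<mu> R f else 0)"
    proof (rule sum.cong[OF refl])
      fix S assume "S \<in> F"
      from average_paraproduct_term_diff[OF R P pos Fc[OF this], of "average \<mu> S f"]
      show "average \<mu> P (u S) - average \<mu> R (u S)
          = (if S = R then (average \<mu> P b - average \<mu> R b) * average \<mu> R f else 0)"
        unfolding u_def[abs_def] by (cases "S = R") simp_all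
    qed
    also have "\<dots> = (average \<mu> P b - average \<mu> R b) * average \<mu> R f" using F by simp
    finally show "average \<mu> P (\<lambda>x. \<Sum>S\<in>F. u S x) - average \<mu> R (\<lambda>x. \<Sum>S\<in>F. u S x)
        = (average \<mu> P b - average \<mu> R b) * average \<mu> R f" .
  qed (use R in auto)
  ultimately show ?thesis
    by (rule tendsto_unique[OF finite_subsets_at_top_neq_bot])
qed

end

end

section \<open>Oscillation and compactness\<close>

text \<open>Isolates the argument by contradiction common to heavy, light and distant cubes: failure
  produces one cube per power of two with oscillation above a fixed \<open>e\<close>. Monotonicity
  is asked from 1 on, since light cubes are described through \<open>1 / M\<close>.\<close>

lemma SUP_tendsto_0_sequentialI:
  fixes \<phi> :: "'a \<Rightarrow> ennreal" and S :: "real \<Rightarrow> 'a set"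
  assumes anti: "\<And>m M. 1 \<le> m \<Longrightarrow> m \<le> M \<Longrightarrow> S M \<subseteq> S m"
    and seq: "\<And>Q e. (\<And>n. Q n \<in> S (2 ^ n)) \<Longrightarrow> 0 < e \<Longrightarrow> (\<And>n. ennreal e < \<phi> (Q n)) \<Longrightarrow> False"
  shows "((\<lambda>M. SUP Q\<in>S M. \<phi> Q) \<longlongrightarrow> 0) at_top"
proof (rule order_tendstoI)
  fix y :: ennreal assume "0 < y"
  \<comment> \<open>An intermediate \<open>z\<close> is finite and leaves room for the supremum to
    be strictly below \<open>y\<close>.\<close>
  then obtain z where z: "0 < z" "z < y" using dense by blast
  define e where "e = enn2real z"
  have e: "ennreal e = z" "0 < e"
    using z by (auto simp: e_def enn2real_positive_iff ennreal_enn2real_if intro: order_less_trans less_le_trans)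
  have "\<exists>n. \<forall>Q\<in>S (2 ^ n). \<phi> Q \<le> ennreal e"
  proof (rule ccontr)
    assume "\<nexists>n. \<forall>Q\<in>S (2 ^ n). \<phi> Q \<le> ennreal e"
    then have "\<forall>n. \<exists>Q. Q \<in> S (2 ^ n) \<and> ennreal e < \<phi> Q" by (auto simp: not_le)
    then obtain Q where "\<And>n. Q n \<in> S (2 ^ n) \<and> ennreal e < \<phi> (Q n)" by metis
    then show False using seq[of Q e] e by blast
  qed
  then obtain n where n: "\<forall>Q\<in>S (2 ^ n). \<phi> Q \<le> ennreal e" ..
  show "\<forall>\<^sub>F M in at_top. (SUP Q\<in>S M. \<phi> Q) < y"
    using eventually_ge_at_top[of "2 ^ n"]
  proof eventually_elim
    case (elim M)
    have "(SUP Q\<in>S M. \<phi> Q) \<le> z" using n anti[OF _ elim] e by (intro SUP_least) auto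
    then show ?case using z by simp
  qed
qed simp

text \<open>The \<open>p\<close>-th power of \<open>osc\<close> for cubes of positive measure,
  without the root and the null-set convention.\<close>

definition osc_powr ::
  "real \<Rightarrow> 'a measure \<Rightarrow> ('a \<Rightarrow> 'b::{real_normed_field, banach, second_countable_topology})
    \<Rightarrow> 'a set \<Rightarrow> ennreal" where
  "osc_powr p \<mu> b Q = (\<integral>\<^sup>+x\<in>Q. ennreal (norm (b x - average \<mu> Q b) powr p) \<partial>\<mu>) / emeasure \<mu> Q"

text \<open>A strict lower bound excludes null sets, where \<open>osc\<close> is 0, so cubes chosen
  for their large oscillation automatically admit a normalised indicator.\<close>

lemma less_osc_iff:
  assumes "0 < p" "0 \<le> e"
  shows "ennreal e < osc p \<mu> b Q \<longleftrightarrow> 0 < emeasure \<mu> Q \<and> ennreal (e powr p) < osc_powr p \<mu> b Q"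
proof (cases "emeasure \<mu> Q = 0")
  case True
  then show ?thesis by (simp add: osc_def)
next
  case False
  then have "osc p \<mu> b Q = ennreal_powr (osc_powr p \<mu> b Q) (1 / p)"
    by (simp add: osc_def osc_powr_def)
  with ennreal_powr_le_iff[OF assms, of "osc_powr p \<mu> b Q"] False show ?thesis
    by (metis not_le zero_less_iff_neq_zero)
qed

lemma powr_minus_inverse_powr:
  fixes m p :: real
  assumes "0 < p" "0 < m"
  shows "(m powr (- 1 / p)) powr p = 1 / m"
proof -
  have "(m powr (- 1 / p)) powr p = m powr (- 1 / p * p)" by (rule powr_powr)
  also have "- 1 / p * p = - 1" using assms by simp
  finally show ?thesis using assms by (simp add: powr_minus_divide)
qed

section \<open>Normalised indicators as test functions\<close>

context dyadic_measure
begin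

definition test_function :: "real \<Rightarrow> (real ^ 'd) set \<Rightarrow> real ^ 'd \<Rightarrow> 'b::{real_normed_field, banach, second_countable_topology}" where
  "test_function p Q x = of_real (measure \<mu> Q powr (- 1 / p)) * indicator Q x"

lemma measure_cube_pos: "Q \<in> cubes \<Longrightarrow> 0 < emeasure \<mu> Q \<Longrightarrow> 0 < measure \<mu> Q"
  using cube_emeasure[of Q] by simp

lemma test_function_Lp:
  fixes Q :: "(real ^ 'd) set"
  assumes p: "0 < p" and Q: "Q \<in> cubes" "0 < emeasure \<mu> Q"
  shows "(test_function p Q :: _ \<Rightarrow> 'b::{real_normed_field, banach, second_countable_topology}) \<in> Lp p \<mu>"
    and "Lp_norm p \<mu> (test_function p Q :: _ \<Rightarrow> 'b) \<le> ennreal 1"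
proof -
  let ?f = "test_function p Q :: _ \<Rightarrow> 'b"
  let ?m = "measure \<mu> Q"
  have m: "0 < ?m" by (rule measure_cube_pos[OF Q])
  have "(\<integral>\<^sup>+x. ennreal (norm (?f x) powr p) \<partial>\<mu>) = (\<integral>\<^sup>+x. ennreal (1 / ?m) * indicator Q x \<partial>\<mu>)"
  proof (rule nn_integral_cong)
    fix x
    show "ennreal (norm (?f x) powr p) = ennreal (1 / ?m) * indicator Q x"
      using powr_minus_inverse_powr[OF p m]
      by (cases "x \<in> Q") (simp_all add: test_function_def norm_mult del: minus_divide_left)
  qed
  also have "\<dots> = ennreal (1 / ?m) * ennreal ?m"
    using cube_sets[OF Q(1)] cube_emeasure[OF Q(1)] by (simp add: nn_integral_cmult_indicator)
  also have "\<dots> = ennreal (1 powr p)" using m by (simp flip: ennreal_mult)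
  finally show le: "Lp_norm p \<mu> ?f \<le> ennreal 1"
    using p by (subst Lp_norm_le_iff) auto
  have "?f \<in> borel_measurable \<mu>"
    unfolding test_function_def[abs_def]
    using cube_sets[OF Q(1)] by measurable
  then show "?f \<in> Lp p \<mu>" using le by (simp add: Lp_def order_le_less_trans[OF le])
qed

lemma average_test_function_subcube:
  assumes "R \<in> cubes" "0 < emeasure \<mu> R" "R \<subseteq> Q"
  shows "average \<mu> R (test_function p Q) = (of_real (measure \<mu> Q powr (- 1 / p))
    :: 'b::{real_normed_field, banach, second_countable_topology})"
  using assms cube_sets cube_finite by (intro average_const_on) (auto simp: test_function_def)

text \<open>The function takes only the value 0 and its height, so no average exceeds the height.
  The bound is independent of \<open>R\<close> and tends to 0 as \<open>Q\<close> becomes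
  heavy.\<close>

lemma norm_average_test_function_le:
  assumes R: "R \<in> cubes" and Q: "Q \<in> cubes"
  shows "norm (average \<mu> R (test_function p Q)
    :: 'b::{real_normed_field, banach, second_countable_topology}) \<le> measure \<mu> Q powr (- 1 / p)"
proof (cases "emeasure \<mu> R = 0")
  case True
  then show ?thesis by (simp add: average_def)
next
  case False
  then have pos: "0 < emeasure \<mu> R" by (simp add: zero_less_iff_neq_zero)
  consider "R \<subseteq> Q" | "R \<inter> Q = {}" | "Q \<subset> R" using cubes_nested[OF R Q] by blast
  then show ?thesis
  proof cases
    case 1
    show ?thesis by (subst average_test_function_subcube[OF R pos 1]) simp
  next
    case 2
    have "average \<mu> R (test_function p Q) = (0 :: 'b)"
      using 2 pos cube_sets[OF R] cube_finite[OF R]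
      by (intro average_const_on) (auto simp: test_function_def indicator_def)
    then show ?thesis by simp
  next
    case 3
    let ?s = "measure \<mu> Q powr (- 1 / p)"
    have m: "0 < measure \<mu> R" by (rule measure_cube_pos[OF R pos])
    have "measure \<mu> Q \<le> measure \<mu> R"
      using 3 R Q cube_sets cube_emeasure[OF R] emeasure_mono[of Q R \<mu>] cube_emeasure[OF Q]
      by (auto simp: ennreal_le_iff)
    moreover have "(LINT x:R|\<mu>. test_function p Q x) = measure \<mu> Q *\<^sub>R (of_real ?s :: 'b)"
    proof -
      have "(LINT x:R|\<mu>. test_function p Q x) = (LINT x:Q|\<mu>. of_real ?s :: 'b)"
        unfolding set_lebesgue_integral_def
        using 3 by (intro Bochner_Integration.integral_cong) (auto simp: test_function_def indicator_def)
      then show ?thesis using cube_sets[OF Q] cube_finite[OF Q] by (simp add: set_integral_const)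
    qed
    ultimately show ?thesis
      using m False by (simp add: average_def field_simps mult_right_mono)
  qed
qed

context
  fixes p :: real
    and b :: "real ^ 'd \<Rightarrow> 'b::{real_normed_field, banach, second_countable_topology}"
  assumes p: "1 < p" and b: "b \<in> L1_loc \<mu>"
begin

text \<open>On \<open>Q\<close> the paraproduct of the normalised indicator of \<open>Q\<close> is a multiple of \<open>b\<close> up to an
  additive constant, which oscillations do not see.\<close>
lemma osc_powr_le_paraproduct_test_function:
  assumes Q: "Q \<in> cubes" and pos: "0 < emeasure \<mu> Q"
    and conv: "paraproduct_converges_to p cubes \<mu> b (test_function p Q) g"
  shows "osc_powr p \<mu> b Q
    \<le> ennreal (2 powr p * (1 + 2 powr p)) * (\<integral>\<^sup>+x\<in>Q. ennreal (norm (g x - c) powr p) \<partial>\<mu>)"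
proof -
  define m where "m = measure \<mu> Q"
  define s where "s = m powr (- 1 / p)"
  have m: "0 < m" unfolding m_def by (rule measure_cube_pos[OF Q pos])
  then have s: "0 < s" by (simp add: s_def)
  have sp: "s powr p = 1 / m" unfolding s_def using p m by (intro powr_minus_inverse_powr) auto
  note Qs = cube_sets[OF Q] and Qf = cube_finite[OF Q]
  have g: "g \<in> Lp p \<mu>" using conv by (simp add: paraproduct_converges_to_def)
  have int_g: "set_integrable \<mu> A g" if "A \<in> cubes" for A
    by (rule Lp_set_integrable[OF p cube_sets[OF that] cube_finite[OF that] g])
  have int_b: "set_integrable \<mu> A (\<lambda>x. of_real s * b x)" if "A \<in> cubes" for A
    using L1_loc_integrable_cube[OF b that] by simp
  have avg: "average \<mu> A (\<lambda>x. g x - of_real s * b x) = average \<mu> A g - of_real s * average \<mu> A b"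
    if "A \<in> cubes" for A
    using average_diff[OF int_g[OF that] int_b[OF that]]
      average_cmult[OF L1_loc_integrable_cube[OF b that]] by simp
  \<comment> \<open>Inside \<open>Q\<close> the average of the test function is its height
    \<open>s\<close>, so from a cube to its children \<open>g\<close> jumps by \<open>s\<close>
    times the jump of \<open>b\<close>; the difference has no jumps at all.\<close>
  have "\<exists>c. AE x\<in>Q in \<mu>. g x - of_real s * b x = c"
  proof (rule AE_const_of_child_averages_eq[OF Q])
    show "set_integrable \<mu> Q (\<lambda>x. g x - of_real s * b x)"
      using int_g[OF Q] int_b[OF Q] by (rule set_integral_diff)
    fix R P assume R: "R \<in> cubes" "R \<subseteq> Q" and P: "P \<in> dyadic_children cubes R" "0 < emeasure \<mu> P"
    note Pc = child_cube[OF P(1)]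
    have "P \<subseteq> R" using child_strict_subset[OF P(1)] by simp
    then have Rpos: "0 < emeasure \<mu> R" using subcube_pos[OF Pc R(1)] P(2) by blast
    have "average \<mu> P g - average \<mu> R g = (average \<mu> P b - average \<mu> R b) * of_real s"
      using average_paraproduct_diff[OF b p conv R(1) P] average_test_function_subcube[where 'b = 'b, OF R(1) Rpos R(2)]
      by (simp add: s_def m_def)
    then show "average \<mu> P (\<lambda>x. g x - of_real s * b x) = average \<mu> R (\<lambda>x. g x - of_real s * b x)"
      unfolding avg[OF Pc] avg[OF R(1)] by (simp add: algebra_simps)
  qed
  then obtain c0 where c0: "AE x\<in>Q in \<mu>. g x - of_real s * b x = c0" ..
  \<comment> \<open>Makes \<open>g x - c\<close> equal to \<open>s\<close> times
    \<open>b x - c'\<close> on \<open>Q\<close>, so that any constant for \<open>g\<close>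
    corresponds to one for \<open>b\<close>.\<close>
  define c' where "c' = (c - c0) / of_real s"
  have "AE x\<in>Q in \<mu>. norm (b x - c') powr p = m * norm (g x - c) powr p"
    using c0
  proof eventually_elim
    case (elim x)
    show ?case
    proof
      assume "x \<in> Q"
      with elim have "g x - of_real s * b x = c0" ..
      then have "g x - c = of_real s * (b x - c')"
        using s by (simp add: c'_def field_simps)
      then show "norm (b x - c') powr p = m * norm (g x - c) powr p"
        using s m sp by (simp add: norm_mult powr_mult)
    qed
  qed
  then have "(\<integral>\<^sup>+x\<in>Q. ennreal (norm (b x - c') powr p) \<partial>\<mu>)
      = (\<integral>\<^sup>+x. ennreal m * (ennreal (norm (g x - c) powr p) * indicator Q x) \<partial>\<mu>)"
    using m by (intro nn_integral_cong_AE) (auto elim!: eventually_mono simp: indicator_def ennreal_mult)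
  also have "\<dots> = ennreal m * (\<integral>\<^sup>+x\<in>Q. ennreal (norm (g x - c) powr p) \<partial>\<mu>)"
    using g Qs by (intro nn_integral_cmult) (auto simp: Lp_def)
  finally have eq: "(\<integral>\<^sup>+x\<in>Q. ennreal (norm (b x - c') powr p) \<partial>\<mu>)
      = ennreal m * (\<integral>\<^sup>+x\<in>Q. ennreal (norm (g x - c) powr p) \<partial>\<mu>)" .
  have "osc_powr p \<mu> b Q \<le> (ennreal (2 powr p * (1 + 2 powr p))
      * (ennreal m * (\<integral>\<^sup>+x\<in>Q. ennreal (norm (g x - c) powr p) \<partial>\<mu>))) / emeasure \<mu> Q"
    unfolding osc_powr_def eq[symmetric]
    by (intro divide_right_mono_ennreal nn_integral_powr_minus_average_le p Qs pos Qf
        L1_loc_measurable b L1_loc_integrable_cube Q)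
  also have "\<dots> = (ennreal (2 powr p * (1 + 2 powr p))
      * (\<integral>\<^sup>+x\<in>Q. ennreal (norm (g x - c) powr p) \<partial>\<mu>)) * ennreal m / ennreal m"
    unfolding cube_emeasure[OF Q] m_def by (simp only: mult_ac)
  \<comment> \<open>The factor \<open>m\<close>, the reciprocal of \<open>s powr p\<close>, cancels
    against the division by the measure of \<open>Q\<close> in the oscillation.\<close>
  also have "\<dots> = ennreal (2 powr p * (1 + 2 powr p)) * (\<integral>\<^sup>+x\<in>Q. ennreal (norm (g x - c) powr p) \<partial>\<mu>)"
    using m by (intro ennreal_mult_divide_eq) auto
  finally show ?thesis .
qed

section \<open>Compactness along a sequence of cubes\<close>

text \<open>The test functions lie in the unit ball of \<open>L^p\<close>, so compactness applies.
  From the operator nothing is kept but its values \<open>h n\<close>, which are sums of the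
  paraproduct series.\<close>

lemma compact_paraproduct_subsequence:
  assumes cpt: "paraproduct_compact p cubes \<mu> b"
    and Q: "\<And>n. Q n \<in> cubes" "\<And>n. 0 < emeasure \<mu> (Q n)"
  obtains r :: "nat \<Rightarrow> nat" and g :: "real ^ 'd \<Rightarrow> 'b" and h
  where "strict_mono r" "g \<in> Lp p \<mu>"
    "\<forall>n. paraproduct_converges_to p cubes \<mu> b (test_function p (Q (r n))) (h n)"
    "(\<lambda>n. Lp_norm p \<mu> (\<lambda>x. h n x - g x)) \<longlonglongrightarrow> 0"
proof -
  obtain T where T: "\<And>f. f \<in> Lp p \<mu> \<Longrightarrow> paraproduct_converges_to p cubes \<mu> b f (T f)"
    and cT: "compact_operator_Lp p \<mu> T"
    using cpt unfolding paraproduct_compact_def by blast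
  let ?f = "\<lambda>n. test_function p (Q n) :: _ \<Rightarrow> 'b"
  have bounded: "\<forall>n. ?f n \<in> Lp p \<mu> \<and> Lp_norm p \<mu> (?f n) \<le> ennreal 1"
    using test_function_Lp[where 'b = 'b, OF _ Q] p by simp
  have "\<exists>r. \<exists>g\<in>Lp p \<mu>. strict_mono r \<and> (\<lambda>n. Lp_norm p \<mu> (\<lambda>x. T (?f (r n)) x - g x)) \<longlonglongrightarrow> 0"
    by (rule cT[unfolded compact_operator_Lp_def, THEN conjunct2, THEN spec, THEN spec, THEN mp, OF bounded])
  then obtain r :: "nat \<Rightarrow> nat" and g where "strict_mono r" "g \<in> Lp p \<mu>"
    "(\<lambda>n. Lp_norm p \<mu> (\<lambda>x. T (?f (r n)) x - g x)) \<longlonglongrightarrow> 0"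
    by (elim exE bexE conjE)
  moreover have "\<forall>n. paraproduct_converges_to p cubes \<mu> b (test_function p (Q (r n))) (T (test_function p (Q (r n))))"
    by (intro allI T) (use bounded in simp)
  ultimately show ?thesis by (intro that[of r g "\<lambda>n. T (test_function p (Q (r n)))"])
qed

text \<open>Here \<delta> is the \<open>p\<close>-th power of the \<open>L^p\<close> distance from
  the images of the test functions to their limit \<open>g\<close>. The constant \<open>c\<close>
  stays free and may vary with \<open>n\<close>: 0 serves for light and distant cubes and for
  boundedness, the value of \<open>g\<close> on the cube for heavy ones. The heavy case belongs to
  the same conclusion because it speaks of the same \<open>g\<close>.\<close>

lemma osc_powr_subsequence_le:
  assumes cpt: "paraproduct_compact p cubes \<mu> b"
    and Q: "\<And>n. Q n \<in> cubes" "\<And>n. 0 < emeasure \<mu> (Q n)"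
  obtains r :: "nat \<Rightarrow> nat" and g :: "real ^ 'd \<Rightarrow> 'b" and \<delta> :: "nat \<Rightarrow> ennreal" and K :: real
  where "strict_mono r" "g \<in> Lp p \<mu>" "\<delta> \<longlonglongrightarrow> 0"
    "\<forall>n c. osc_powr p \<mu> b (Q (r n))
      \<le> ennreal K * (\<delta> n + (\<integral>\<^sup>+x\<in>Q (r n). ennreal (norm (g x - c) powr p) \<partial>\<mu>))"
    "filterlim (\<lambda>n. measure \<mu> (Q n)) at_top sequentially \<longrightarrow>
      (\<forall>R\<in>cubes. \<exists>c. AE x\<in>R in \<mu>. g x = c)"
proof -
  obtain r g h where r: "strict_mono r" and g: "g \<in> Lp p \<mu>"
    and conv: "\<forall>n. paraproduct_converges_to p cubes \<mu> b (test_function p (Q (r n))) (h n)"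
    and lim: "(\<lambda>n. Lp_norm p \<mu> (\<lambda>x. h n x - g x)) \<longlonglongrightarrow> 0"
    by (rule compact_paraproduct_subsequence[where Q = Q, OF cpt Q]) (rule that)
  note conv = conv[rule_format]
  have h: "h n \<in> Lp p \<mu>" for n using conv by (simp add: paraproduct_converges_to_def)
  have meas[measurable]: "g \<in> borel_measurable \<mu>" "h n \<in> borel_measurable \<mu>" for n
    using g h by (auto simp: Lp_def)
  define \<delta> where "\<delta> n = (\<integral>\<^sup>+x. ennreal (norm (h n x - g x) powr p) \<partial>\<mu>)" for n
  \<comment> \<open>The last factor comes from inserting \<open>g\<close> between \<open>h n\<close>
    and \<open>c\<close>, the others from the oscillation bound for a single cube.\<close>
  define K where "K = 2 powr p * (1 + 2 powr p) * 2 powr p"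
  show ?thesis
  proof (rule that[OF r g, of \<delta> K]; (intro allI impI)?)
    show "\<delta> \<longlonglongrightarrow> 0"
      unfolding \<delta>_def using p by (intro nn_integral_tendsto_0_of_Lp_norm lim) auto
  next
    fix n c
    let ?Q = "Q (r n)"
    have [measurable]: "?Q \<in> sets \<mu>" by (rule cube_sets[OF Q(1)])
    have "(\<integral>\<^sup>+x\<in>?Q. ennreal (norm (h n x - c) powr p) \<partial>\<mu>)
      \<le> (\<integral>\<^sup>+x. ennreal (2 powr p) * (ennreal (norm (h n x - g x) powr p)
            + ennreal (norm (g x - c) powr p) * indicator ?Q x) \<partial>\<mu>)"
    proof (rule nn_integral_mono)
      fix x
      have "norm (h n x - c) powr p \<le> (norm (h n x - g x) + norm (g x - c)) powr p"
        using p norm_triangle_ineq[of "h n x - g x" "g x - c"] by (intro powr_mono2) auto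
      also have "\<dots> \<le> 2 powr p * (norm (h n x - g x) powr p + norm (g x - c) powr p)"
        using p by (intro powr_add_le) auto
      finally have "ennreal (norm (h n x - c) powr p)
          \<le> ennreal (2 powr p) * (ennreal (norm (h n x - g x) powr p) + ennreal (norm (g x - c) powr p))"
        by (simp add: ennreal_leI flip: ennreal_mult ennreal_plus)
      then show "ennreal (norm (h n x - c) powr p) * indicator ?Q x
          \<le> ennreal (2 powr p) * (ennreal (norm (h n x - g x) powr p)
            + ennreal (norm (g x - c) powr p) * indicator ?Q x)"
        by (auto simp: indicator_def)
    qed
    also have "\<dots> = ennreal (2 powr p) * (\<delta> n + (\<integral>\<^sup>+x\<in>?Q. ennreal (norm (g x - c) powr p) \<partial>\<mu>))"
      by (simp add: nn_integral_cmult nn_integral_add \<delta>_def)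
    finally have "ennreal (2 powr p * (1 + 2 powr p)) * (\<integral>\<^sup>+x\<in>?Q. ennreal (norm (h n x - c) powr p) \<partial>\<mu>)
        \<le> ennreal (2 powr p * (1 + 2 powr p))
          * (ennreal (2 powr p) * (\<delta> n + (\<integral>\<^sup>+x\<in>?Q. ennreal (norm (g x - c) powr p) \<partial>\<mu>)))"
      by (intro mult_left_mono) auto
    also have "\<dots> = ennreal K * (\<delta> n + (\<integral>\<^sup>+x\<in>?Q. ennreal (norm (g x - c) powr p) \<partial>\<mu>))"
      by (simp add: K_def ennreal_mult mult.assoc)
    finally show "osc_powr p \<mu> b ?Q \<le> ennreal K * (\<delta> n + (\<integral>\<^sup>+x\<in>?Q. ennreal (norm (g x - c) powr p) \<partial>\<mu>))"
      using osc_powr_le_paraproduct_test_function[OF Q(1) Q(2) conv, of n c] by (rule order_trans[rotated])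
  next
    assume heavy: "filterlim (\<lambda>n. measure \<mu> (Q n)) at_top sequentially"
    have "(\<lambda>n. measure \<mu> (Q n) powr (- 1 / p)) \<longlonglongrightarrow> 0"
      using p by (intro tendsto_neg_powr heavy) auto
    then have small: "(\<lambda>n. measure \<mu> (Q (r n)) powr (- 1 / p)) \<longlonglongrightarrow> 0"
      using LIMSEQ_subseq_LIMSEQ[OF _ r] by (auto simp: comp_def)
    show "\<forall>R\<in>cubes. \<exists>c. AE x\<in>R in \<mu>. g x = c"
    proof
      fix R assume R: "R \<in> cubes"
      have tends: "(\<lambda>n. average \<mu> A (h n)) \<longlonglongrightarrow> average \<mu> A g" if A: "A \<in> cubes" for A
        using Lp_set_integrable[OF p cube_sets[OF A] cube_finite[OF A] h]
        by (intro average_tendsto[OF p cube_sets[OF A] cube_finite[OF A] _ g lim]) auto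
      show "\<exists>c. AE x\<in>R in \<mu>. g x = c"
      proof (rule AE_const_of_child_averages_eq[OF R])
        show "set_integrable \<mu> R g"
          by (rule Lp_set_integrable[OF p cube_sets[OF R] cube_finite[OF R] g])
        fix S P assume S: "S \<in> cubes" and P: "P \<in> dyadic_children cubes S" "0 < emeasure \<mu> P"
        \<comment> \<open>These jumps are a fixed jump of \<open>b\<close> times averages of the
          test functions over the fixed cube \<open>S\<close>, and the heights bounding those
          averages tend to 0.\<close>
        have "(\<lambda>n. average \<mu> P (h n) - average \<mu> S (h n)) \<longlonglongrightarrow> average \<mu> P g - average \<mu> S g"
          by (intro tendsto_diff tends S child_cube[OF P(1)])
        moreover have "(\<lambda>n. average \<mu> S (test_function p (Q (r n)) :: _ \<Rightarrow> 'b)) \<longlonglongrightarrow> 0"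
          by (rule Lim_null_comparison[OF _ small])
            (intro always_eventually allI norm_average_test_function_le[OF S Q(1)])
        then have "(\<lambda>n. (average \<mu> P b - average \<mu> S b) * average \<mu> S (test_function p (Q (r n)))) \<longlonglongrightarrow> 0"
          by (rule tendsto_mult_right_zero)
        then have "(\<lambda>n. average \<mu> P (h n) - average \<mu> S (h n)) \<longlonglongrightarrow> 0"
          by (simp add: average_paraproduct_diff[OF b p conv S P])
        ultimately have "average \<mu> P g - average \<mu> S g = 0" by (rule LIMSEQ_unique)
        then show "average \<mu> P g = average \<mu> S g" by simp
      qed
    qed
  qed
qed

text \<open>Dominated convergence with majorant \<open>norm (g x) powr p\<close>. Writing
  \<open>g x - 0\<close> matches the oscillation bound at \<open>c = 0\<close>.\<close>

lemma nn_integral_vanishing_cubes: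
  fixes g :: "real ^ 'd \<Rightarrow> 'b"
  assumes g: "g \<in> Lp p \<mu>" and A: "\<And>n. A n \<in> cubes"
    and ev: "AE x in \<mu>. \<forall>\<^sub>F n in sequentially. x \<notin> A n"
  shows "(\<lambda>n. \<integral>\<^sup>+x\<in>A n. ennreal (norm (g x - 0) powr p) \<partial>\<mu>) \<longlonglongrightarrow> 0"
proof -
  have [measurable]: "g \<in> borel_measurable \<mu>" "A n \<in> sets \<mu>" for n
    using g cube_sets[OF A] by (auto simp: Lp_def)
  have "(\<lambda>n. \<integral>\<^sup>+x\<in>A n. ennreal (norm (g x - 0) powr p) \<partial>\<mu>) \<longlonglongrightarrow> (\<integral>\<^sup>+x. 0 \<partial>\<mu>)"
  proof (rule nn_integral_dominated_convergence[where w = "\<lambda>x. ennreal (norm (g x) powr p)"])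
    show "AE x in \<mu>. (\<lambda>n. ennreal (norm (g x - 0) powr p) * indicator (A n) x) \<longlonglongrightarrow> 0"
      using ev
    proof eventually_elim
      case (elim x)
      have "\<forall>\<^sub>F n in sequentially. ennreal (norm (g x - 0) powr p) * indicator (A n) x = 0"
        using elim by (rule eventually_mono) simp
      then show ?case by (rule tendsto_eventually)
    qed
    show "(\<integral>\<^sup>+x. ennreal (norm (g x) powr p) \<partial>\<mu>) < \<infinity>"
      using g p by (intro Lp_nn_integral_finite) auto
  qed (auto simp: indicator_def)
  then show ?thesis by simp
qed

lemma osc_powr_bounded_below_impossible:
  assumes lim: "\<delta> \<longlonglongrightarrow> 0" "I \<longlonglongrightarrow> 0" and e: "0 < e"
    and le: "\<And>n. ennreal (e powr p) < X n" "\<And>n. X n \<le> ennreal K * (\<delta> n + I n)"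
  shows False
proof -
  have "(\<lambda>n. ennreal K * (\<delta> n + I n)) \<longlonglongrightarrow> ennreal K * (0 + 0)"
    by (intro ennreal_tendsto_cmult tendsto_add lim) auto
  then have "\<forall>\<^sub>F n in sequentially. ennreal K * (\<delta> n + I n) < ennreal (e powr p)"
    using e by (intro order_tendstoD(2)) auto
  then obtain n where "ennreal K * (\<delta> n + I n) < ennreal (e powr p)"
    by (auto simp: eventually_sequentially)
  then show False using le[of n] by (meson leD order_less_le_trans less_imp_le)
qed

text \<open>Serves both light and distant cubes: the mass of \<open>g\<close> on them tends to 0, so
  the choice \<open>c = 0\<close> drives the oscillation bound to 0. Avoidance is required along
  every subsequence because compactness selects \<open>r\<close>.\<close>

lemma vanishing_cubes_osc_impossible:
  assumes cpt: "paraproduct_compact p cubes \<mu> b"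
    and Q: "\<And>n. Q n \<in> cubes" and e: "0 < e" "\<And>n. ennreal e < osc p \<mu> b (Q n)"
    and ev: "\<And>r :: nat \<Rightarrow> nat. strict_mono r \<Longrightarrow> AE x in \<mu>. \<forall>\<^sub>F n in sequentially. x \<notin> Q (r n)"
  shows False
proof -
  have e': "0 < emeasure \<mu> (Q n)" "ennreal (e powr p) < osc_powr p \<mu> b (Q n)" for n
    using e less_osc_iff[of p e \<mu> b "Q n"] p by auto
  obtain r :: "nat \<Rightarrow> nat" and g :: "real ^ 'd \<Rightarrow> 'b" and \<delta> K
    where r: "strict_mono r" and g: "g \<in> Lp p \<mu>" and \<delta>: "\<delta> \<longlonglongrightarrow> 0"
    and le: "\<forall>n c. osc_powr p \<mu> b (Q (r n))
      \<le> ennreal K * (\<delta> n + (\<integral>\<^sup>+x\<in>Q (r n). ennreal (norm (g x - c) powr p) \<partial>\<mu>))"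
    by (rule osc_powr_subsequence_le[where Q = Q, OF cpt Q e'(1)]) (rule that)
  show False
    using \<delta> nn_integral_vanishing_cubes[OF g Q ev[OF r]] e(1) e'(2) le[rule_format]
    by (rule osc_powr_bounded_below_impossible)
qed

section \<open>Bounded and vanishing oscillation\<close>

text \<open>Unbounded oscillations would give cubes \<open>Q n\<close> with oscillation above
  \<open>n\<close>, while the subsequence bound with \<open>c = 0\<close> keeps the
  \<open>p\<close>-th powers below \<open>K * (1 + J)\<close> as soon as \<delta> drops below
  1.\<close>

lemma paraproduct_compact_imp_BMO:
  assumes cpt: "paraproduct_compact p cubes \<mu> b"
  shows "b \<in> BMO p cubes \<mu>"
proof -
  have "(SUP Q\<in>cubes. osc p \<mu> b Q) < \<infinity>"
  proof (rule ccontr)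
    assume "\<not> ?thesis"
    then have top: "(SUP Q\<in>cubes. osc p \<mu> b Q) = top" by (metis infinity_ennreal_def less_top)
    have "\<exists>Q\<in>cubes. ennreal (real n) < osc p \<mu> b Q" for n
      unfolding less_SUP_iff[symmetric] top by simp
    then obtain Q where Q: "\<And>n. Q n \<in> cubes" "\<And>n. ennreal (real n) < osc p \<mu> b (Q n)" by metis
    have pos: "0 < emeasure \<mu> (Q n)" and big: "ennreal (real n powr p) < osc_powr p \<mu> b (Q n)" for n
      using Q(2) less_osc_iff[of p "real n" \<mu> b "Q n"] p by auto
    obtain r :: "nat \<Rightarrow> nat" and g :: "real ^ 'd \<Rightarrow> 'b" and \<delta> K
      where r: "strict_mono r" and g: "g \<in> Lp p \<mu>" and \<delta>: "\<delta> \<longlonglongrightarrow> 0"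
      and le: "\<forall>n c. osc_powr p \<mu> b (Q (r n))
        \<le> ennreal K * (\<delta> n + (\<integral>\<^sup>+x\<in>Q (r n). ennreal (norm (g x - c) powr p) \<partial>\<mu>))"
      by (rule osc_powr_subsequence_le[where Q = Q, OF cpt Q(1) pos]) (rule that)
    define J where "J = (\<integral>\<^sup>+x. ennreal (norm (g x) powr p) \<partial>\<mu>)"
    have "J < \<infinity>" unfolding J_def using p by (intro Lp_nn_integral_finite g) auto
    then have fin: "ennreal K * (1 + J) < \<infinity>" by (simp add: ennreal_mult_less_top)
    define C where "C = enn2real (ennreal K * (1 + J))"
    have C: "ennreal K * (1 + J) = ennreal C" using fin by (simp add: C_def)
    have "\<forall>\<^sub>F n in sequentially. \<delta> n < 1" by (rule order_tendstoD(2)[OF \<delta>]) simp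
    \<comment> \<open>The 1 guarantees that \<open>real (r n)\<close>, which is at least
      \<open>n\<close>, does not exceed its \<open>p\<close>-th power.\<close>
    moreover have "\<forall>\<^sub>F n in sequentially. max 1 C \<le> real n"
      by (rule eventually_sequentiallyI[of "nat \<lceil>max 1 C\<rceil>"]) linarith
    ultimately have "\<forall>\<^sub>F n in sequentially. False"
    proof eventually_elim
      case (elim n)
      have "(\<integral>\<^sup>+x\<in>Q (r n). ennreal (norm (g x - 0) powr p) \<partial>\<mu>) \<le> J"
        unfolding J_def by (intro nn_integral_mono) (auto simp: indicator_def)
      then have "ennreal K * (\<delta> n + (\<integral>\<^sup>+x\<in>Q (r n). ennreal (norm (g x - 0) powr p) \<partial>\<mu>)) \<le> ennreal C"
        unfolding C[symmetric] using elim by (intro mult_left_mono add_mono) auto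
      then have "ennreal (real (r n) powr p) < ennreal C"
        using big[of "r n"] le[rule_format, of n 0] by (meson order_less_le_trans order_trans)
      then have "real (r n) powr p < C" by (simp add: ennreal_less_iff)
      moreover have "n \<le> r n" using r by (rule seq_suble)
      then have "max 1 C \<le> real (r n)" using elim by linarith
      moreover have "real (r n) powr 1 \<le> real (r n) powr p"
        using \<open>max 1 C \<le> real (r n)\<close> p by (intro powr_mono) auto
      ultimately show False by simp
    qed
    then show False by simp
  qed
  then show ?thesis using b by (simp add: BMO_def)
qed

lemma paraproduct_compact_imp_VMO:
  assumes cpt: "paraproduct_compact p cubes \<mu> b"
  shows "b \<in> VMO p cubes \<mu>"
proof -
  have heavy: "((\<lambda>M::real. SUP Q\<in>{Q\<in>cubes. emeasure \<mu> Q \<ge> ennreal M}. osc p \<mu> b Q) \<longlongrightarrow> 0) at_top"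
  proof (rule SUP_tendsto_0_sequentialI)
    show "{Q \<in> cubes. ennreal M \<le> emeasure \<mu> Q} \<subseteq> {Q \<in> cubes. ennreal m \<le> emeasure \<mu> Q}"
      if "m \<le> M" for m M
      using order_trans[OF ennreal_leI[OF that]] by blast
  next
    fix Q e
    assume Q: "\<And>n::nat. Q n \<in> {Q \<in> cubes. ennreal (2 ^ n) \<le> emeasure \<mu> Q}"
      and e: "0 < e" "\<And>n. ennreal e < osc p \<mu> b (Q n)"
    have Qc: "Q n \<in> cubes" and "ennreal (2 ^ n) \<le> ennreal (measure \<mu> (Q n))" for n
      using Q[of n] cube_emeasure[of "Q n"] by auto
    then have ge: "2 ^ n \<le> measure \<mu> (Q n)" for n by (simp add: ennreal_le_iff)
    have infinite: "filterlim (\<lambda>n. measure \<mu> (Q n)) at_top sequentially"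
    proof (rule filterlim_at_top_mono[OF filterlim_real_sequentially always_eventually], rule allI)
      fix n
      show "real n \<le> measure \<mu> (Q n)"
        using ge[of n] of_nat_less_two_power[of n, where 'a = real] by linarith
    qed
    have e': "0 < emeasure \<mu> (Q n)" "ennreal (e powr p) < osc_powr p \<mu> b (Q n)" for n
      using e less_osc_iff[of p e \<mu> b "Q n"] p by auto
    obtain r :: "nat \<Rightarrow> nat" and g :: "real ^ 'd \<Rightarrow> 'b" and \<delta> K
      where \<delta>: "\<delta> \<longlonglongrightarrow> 0"
      and le: "\<forall>n c. osc_powr p \<mu> b (Q (r n))
        \<le> ennreal K * (\<delta> n + (\<integral>\<^sup>+x\<in>Q (r n). ennreal (norm (g x - c) powr p) \<partial>\<mu>))"
      and const: "filterlim (\<lambda>n. measure \<mu> (Q n)) at_top sequentially \<longrightarrow>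
        (\<forall>R\<in>cubes. \<exists>c. AE x\<in>R in \<mu>. g x = c)"
      by (rule osc_powr_subsequence_le[where Q = Q, OF cpt Qc e'(1)]) (rule that)
    \<comment> \<open>The limit is constant on each \<open>Q (r n)\<close>; taking that value, which
      may depend on \<open>n\<close>, as \<open>c\<close> makes the integral vanish.\<close>
    have "osc_powr p \<mu> b (Q (r n)) \<le> ennreal K * (\<delta> n + 0)" for n
    proof -
      obtain c where "AE x\<in>Q (r n) in \<mu>. g x = c" using const infinite Qc[of "r n"] by blast
      then have "AE x in \<mu>. ennreal (norm (g x - c) powr p) * indicator (Q (r n)) x = 0"
        by eventually_elim (auto simp: indicator_def)
      then have "(\<integral>\<^sup>+x\<in>Q (r n). ennreal (norm (g x - c) powr p) \<partial>\<mu>) = (\<integral>\<^sup>+x. 0 \<partial>\<mu>)"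
        by (rule nn_integral_cong_AE)
      then show ?thesis using le[rule_format, of n c] by simp
    qed
    with \<delta> tendsto_const e(1) e'(2) show False by (rule osc_powr_bounded_below_impossible)
  qed
  have light: "((\<lambda>M::real. SUP Q\<in>{Q\<in>cubes. emeasure \<mu> Q \<le> ennreal (1 / M)}. osc p \<mu> b Q) \<longlongrightarrow> 0) at_top"
  proof (rule SUP_tendsto_0_sequentialI)
    show "{Q \<in> cubes. emeasure \<mu> Q \<le> ennreal (1 / M)} \<subseteq> {Q \<in> cubes. emeasure \<mu> Q \<le> ennreal (1 / m)}"
      if "1 \<le> m" "m \<le> M" for m M
    proof -
      have "ennreal (1 / M) \<le> ennreal (1 / m)" using that by (intro ennreal_leI frac_le) auto
      then show ?thesis using order_trans by blast
    qed
  next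
    fix Q e
    assume Q: "\<And>n::nat. Q n \<in> {Q \<in> cubes. emeasure \<mu> Q \<le> ennreal (1 / 2 ^ n)}"
      and e: "0 < e" "\<And>n. ennreal e < osc p \<mu> b (Q n)"
    have Qc: "Q n \<in> cubes" and "ennreal (measure \<mu> (Q n)) \<le> ennreal (1 / 2 ^ n)" for n
      using Q[of n] cube_emeasure[of "Q n"] by auto
    then have small: "measure \<mu> (Q n) \<le> (1 / 2) ^ n" for n
      by (simp add: ennreal_le_iff power_one_over)
    show False
    proof (rule vanishing_cubes_osc_impossible[OF cpt Qc e])
      fix r :: "nat \<Rightarrow> nat" assume r: "strict_mono r"
      have "measure \<mu> (Q (r n)) \<le> (1 / 2) ^ n" for n
      proof -
        have "(1 / 2 :: real) ^ r n \<le> (1 / 2) ^ n" by (intro power_decreasing seq_suble r) auto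
        then show ?thesis using small[of "r n"] by linarith
      qed
      \<comment> \<open>Geometric decay survives passing to a subsequence, since \<open>r n\<close>
        is at least \<open>n\<close>. By Borel-Cantelli almost every point lies in finitely many of
        the cubes.\<close>
      then have "summable (\<lambda>n. measure \<mu> (Q (r n)))"
        by (intro summable_comparison_test'[OF summable_geometric[of "1 / 2 :: real"]]) auto
      then have "AE x in \<mu>. \<forall>\<^sub>F n in sequentially. x \<in> space \<mu> - Q (r n)"
        using cube_sets[OF Qc] cube_finite[OF Qc] by (intro borel_cantelli_AE1)
      then show "AE x in \<mu>. \<forall>\<^sub>F n in sequentially. x \<notin> Q (r n)"
        by (auto elim!: eventually_mono)
    qed
  qed
  have distant: "((\<lambda>M::real. SUP Q\<in>{Q\<in>cubes. infdist 0 Q \<ge> M}. osc p \<mu> b Q) \<longlongrightarrow> 0) at_top"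
  proof (rule SUP_tendsto_0_sequentialI)
    fix Q e
    assume Q: "\<And>n::nat. Q n \<in> {Q \<in> cubes. 2 ^ n \<le> infdist 0 Q}"
      and e: "0 < e" "\<And>n. ennreal e < osc p \<mu> b (Q n)"
    have Qc: "Q n \<in> cubes" and far: "2 ^ n \<le> infdist 0 (Q n)" for n using Q[of n] by auto
    show False
    proof (rule vanishing_cubes_osc_impossible[OF cpt Qc e])
      fix r :: "nat \<Rightarrow> nat" assume r: "strict_mono r"
      \<comment> \<open>A cube containing \<open>x\<close> has distance at most
        \<open>norm x\<close> from 0, so here every point is avoided eventually, without an
        exceptional set.\<close>
      have "\<forall>\<^sub>F n in sequentially. x \<notin> Q (r n)" for x
      proof -
        obtain N where N: "norm x < 2 ^ N" using real_arch_pow[of 2 "norm x"] by auto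
        have "x \<notin> Q (r n)" if "N \<le> n" for n
        proof
          assume "x \<in> Q (r n)"
          then have "infdist 0 (Q (r n)) \<le> norm x" using infdist_le[of x "Q (r n)" 0] by simp
          moreover have "(2::real) ^ N \<le> 2 ^ r n"
            using that seq_suble[OF r, of n] by (intro power_increasing) auto
          ultimately show False using far[of "r n"] N by linarith
        qed
        then show ?thesis by (auto simp: eventually_sequentially)
      qed
      then show "AE x in \<mu>. \<forall>\<^sub>F n in sequentially. x \<notin> Q (r n)" by simp
    qed
  qed auto
  show ?thesis
    unfolding VMO_def using paraproduct_compact_imp_BMO[OF cpt] heavy light distant by simp
qed

end

end

theorem theorem6p6:
  fixes p :: real
    and D :: "(real ^ 'd) set set"
    and \<mu> :: "(real ^ 'd) measure"
    and b :: "real ^ 'd \<Rightarrow> 'b::{real_normed_field, banach, second_countable_topology}"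
  assumes "1 < p"
    and "dyadic_system D"
    and "locally_finite_borel_measure \<mu>"
    and "b \<in> L1_loc \<mu>"
    and "paraproduct_compact p D \<mu> b"
  shows "b \<in> VMO p D \<mu>"
proof -
  obtain G :: "int \<Rightarrow> (real ^ 'd) set set" where G: "\<And>k. partition_on UNIV (G k)"
    "\<And>k Q. Q \<in> G k \<Longrightarrow> \<exists>a. Q = half_open_cube a (2 powi (- k))"
    "\<And>k P. P \<in> G (k + 1) \<Longrightarrow> \<exists>Q\<in>G k. P \<subseteq> Q"
    and D: "D = (\<Union>k. G k)"
    using assms(2) unfolding dyadic_system_def by blast
  interpret dyadic_measure G \<mu>
    by unfold_locales (use G assms(3) in blast)+
  show ?thesis
    using assms(5) unfolding D by (rule paraproduct_compact_imp_VMO[OF assms(1,4)])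
qed

end
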